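(* Every rank one measure-preserving system is measure-theoretically isomorphic to an essentially $0$-expansive rank one system. That is: for every rank one system $(X,\mathcal A,T,\mu)$ there exist a rank one system $(Y,\mathcal B,S,\nu)$ and a rank one construction of $(Y,\mathcal B,S,\nu)$, with tower bases denoted $G_n$, $n\ge 0$, such that the partition $P_0=\{G_0, Y\setminus G_0\}$ generates $\mathcal B$ under $S$ (modulo $\nu$-null sets), and $(Y,\mathcal B,S,\nu)$ is measure-theoretically isomorphic to $(X,\mathcal A,T,\mu)$.
   Context: A measure-preserving system is a nonatomic Lebesgue probability space $(X,\mathcal A,\mu)$ together with an invertible measure-preserving transformation $T$. All statements about sets are modulo null sets. Measure-theoretic isomorphism is the usual notion (a measure-preserving bijection between full-measure invariant sets that intertwines the transformations). Rank one. A measure-preserving system $(X,\mathcal A,T,\mu)$ is rank one if it has a rank one construction, meaning the following data. There are positive integers $q_n$, $n\ge 0$, with $q_n>1$ for infinitely many $n$, and nonnegative integers $a_{n,i}$, $n\ge 0$, $0\le i\le q_n-1$, such that, with $$h_0=1,\qquad h_{n+1}=q_nh_n+\sum_{i=0}^{q_n-1}a_{n,i},$$ one has $$\sum_{n=0}^\infty \frac{\sum_{i=0}^{q_n-1}a_{n,i}}{h_{n+1}}<\infty .$$ There are also measurable subsets $F_n$ ($n\ge 0$), $F_{n,i}$ ($n\ge0$, $0\le i\le q_n-1$) and $S_{n,i,j}$ ($n\ge 0$, $0\le i\le q_n-1$, $0\le j\le a_{n,i}-1$; there are none if $a_{n,i}=0$) of $X$ such that for all $n$: - $(F_{n,i})_{0\le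 i\le q_n-1}$ is a partition of $F_n$; - the sets $T^kF_n$, $0\le k\le h_n-1$, are pairwise disjoint; - $T^{h_n}F_{n,i}=S_{n,i,0}$ if $a_{n,i}\neq 0$; - $T^{h_n}F_{n,i}=F_{n,i+1}$ if $a_{n,i}=0$ and $i<q_n-1$; - $TS_{n,i,j}=S_{n,i,j+1}$ if $j<a_{n,i}-1$; - $TS_{n,i,a_{n,i}-1}=F_{n,i+1}$ if $a_{n,i}\ne0$ and $i<q_n-1$; - $F_{n+1}=F_{n,0}$. Finally, the partitions $P_n=\{F_n,TF_n,\dots,T^{h_n-1}F_n,\ X\setminus\bigcup_{k=0}^{h_n-1}T^kF_n\}$ increase to $\mathcal A$, i.e. each $P_{n+1}$ refines $P_n$ and together they generate $\mathcal A$. The sets $F_n$ are called the tower bases of the construction. Essential $0$-expansiveness. A rank one system given by such a construction is essentially $0$-expansive if the partition $P_0=\{F_0,X\setminus F_0\}$ generates the full $\sigma$-algebra under $T$: the smallest $\sigma$-algebra containing $T^kF_0$ for all $k\in\mathbb Z$ equals $\mathcal A$ modulo null sets. *)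

theory Defs
  imports "HOL-Probability.Probability"
begin

text \<open>
  Statements about sets are read modulo null sets.  Systems are carried by a measure
  \<open>M\<close>; only the values of the transformation on \<open>space M\<close> matter.
\<close>

definition eq_mod_null :: "'a measure \<Rightarrow> 'a set \<Rightarrow> 'a set \<Rightarrow> bool" where
  "eq_mod_null M A B \<longleftrightarrow> sym_diff A B \<in> null_sets M"

definition disjoint_mod_null :: "'a measure \<Rightarrow> 'a set \<Rightarrow> 'a set \<Rightarrow> bool" where
  "disjoint_mod_null M A B \<longleftrightarrow> A \<inter> B \<in> null_sets M"

definition full_measure_set :: "'a measure \<Rightarrow> 'a set \<Rightarrow> bool" where
  "full_measure_set M X \<longleftrightarrow> X \<in> sets M \<and> space M - X \<in> null_sets M"

definition generates_mod_null :: "'a measure \<Rightarrow> 'a set set \<Rightarrow> bool" where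
  "generates_mod_null M C \<longleftrightarrow>
     C \<subseteq> sets M \<and> (\<forall>A\<in>sets M. \<exists>B\<in>sigma_sets (space M) C. eq_mod_null M A B)"

definition isomorphism_on ::
  "'a measure \<Rightarrow> 'a set \<Rightarrow> 'b measure \<Rightarrow> 'b set \<Rightarrow> ('a \<Rightarrow> 'b) \<Rightarrow> bool" where
  "isomorphism_on M X N Y f \<longleftrightarrow>
     full_measure_set M X \<and> full_measure_set N Y \<and> bij_betw f X Y \<and>
     f \<in> measurable (restrict_space M X) (restrict_space N Y) \<and>
     inv_into X f \<in> measurable (restrict_space N Y) (restrict_space M X) \<and>
     distr (restrict_space M X) (restrict_space N Y) f = restrict_space N Y"

text \<open>
  Rokhlin's notion: a complete probability space isomorphic modulo null sets to the unit
  interval with the Lebesgue measurable sets and Lebesgue measure.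
\<close>

definition nonatomic_Lebesgue_space :: "'a measure \<Rightarrow> bool" where
  "nonatomic_Lebesgue_space M \<longleftrightarrow>
     prob_space M \<and> complete_measure M \<and>
     (\<exists>X Y f. isomorphism_on M X (lebesgue_on {0..1::real}) Y f)"

definition measure_preserving_system :: "'a measure \<Rightarrow> ('a \<Rightarrow> 'a) \<Rightarrow> bool" where
  "measure_preserving_system M T \<longleftrightarrow>
     nonatomic_Lebesgue_space M \<and> bij_betw T (space M) (space M) \<and>
     T \<in> measurable M M \<and> inv_into (space M) T \<in> measurable M M \<and> distr M M T = M"

definition isomorphic_systems ::
  "'a measure \<Rightarrow> ('a \<Rightarrow> 'a) \<Rightarrow> 'b measure \<Rightarrow> ('b \<Rightarrow> 'b) \<Rightarrow> bool" where
  "isomorphic_systems M T N S \<longleftrightarrow>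
     (\<exists>X Y f. isomorphism_on M X N Y f \<and> T ` X = X \<and> S ` Y = Y \<and>
        (\<forall>x\<in>X. f (T x) = S (f x)))"

primrec tower_height :: "(nat \<Rightarrow> nat) \<Rightarrow> (nat \<Rightarrow> nat \<Rightarrow> nat) \<Rightarrow> nat \<Rightarrow> nat" where
  "tower_height q a 0 = 1"
| "tower_height q a (Suc n) = q n * tower_height q a n + (\<Sum>i<q n. a n i)"

definition tower_partition ::
  "'a measure \<Rightarrow> ('a \<Rightarrow> 'a) \<Rightarrow> 'a set \<Rightarrow> nat \<Rightarrow> 'a set set" where
  "tower_partition M T B h =
     insert (space M - (\<Union>k<h. (T ^^ k) ` B)) ((\<lambda>k. (T ^^ k) ` B) ` {..<h})"

definition refines_mod_null :: "'a measure \<Rightarrow> 'a set set \<Rightarrow> 'a set set \<Rightarrow> bool" where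
  "refines_mod_null M P Q \<longleftrightarrow> (\<forall>A\<in>P. \<exists>B\<in>Q. A - B \<in> null_sets M)"

text \<open>
  \<open>F n\<close> are the tower bases, \<open>FF n i\<close> (for \<open>i < q n\<close>) the pieces into which
  \<open>F n\<close> is cut, and \<open>W n i j\<close> (for \<open>j < a n i\<close>) the spacers inserted above the
  \<open>i\<close>-th column.  Values at other indices are irrelevant.
\<close>

definition rank_one_construction ::
  "'a measure \<Rightarrow> ('a \<Rightarrow> 'a) \<Rightarrow> (nat \<Rightarrow> nat) \<Rightarrow> (nat \<Rightarrow> nat \<Rightarrow> nat) \<Rightarrow>
   (nat \<Rightarrow> 'a set) \<Rightarrow> (nat \<Rightarrow> nat \<Rightarrow> 'a set) \<Rightarrow> (nat \<Rightarrow> nat \<Rightarrow> nat \<Rightarrow> 'a set) \<Rightarrow> bool" where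
  "rank_one_construction M T q a F FF W \<longleftrightarrow>
     (let h = tower_height q a; P = (\<lambda>n. tower_partition M T (F n) (h n)) in
       (\<forall>n. q n > 0) \<and>
       infinite {n. q n > 1} \<and>
       summable (\<lambda>n. real (\<Sum>i<q n. a n i) / real (h (Suc n))) \<and>
       (\<forall>n. F n \<in> sets M) \<and>
       (\<forall>n. \<forall>i<q n. FF n i \<in> sets M) \<and>
       (\<forall>n. \<forall>i<q n. \<forall>j<a n i. W n i j \<in> sets M) \<and>
       (\<forall>n. eq_mod_null M (\<Union>i<q n. FF n i) (F n)) \<and>
       (\<forall>n. \<forall>i<q n. \<forall>j<q n. i \<noteq> j \<longrightarrow> disjoint_mod_null M (FF n i) (FF n j)) \<and>
       (\<forall>n. \<forall>k<h n. \<forall>l<h n. k \<noteq> l \<longrightarrow>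
          disjoint_mod_null M ((T ^^ k) ` F n) ((T ^^ l) ` F n)) \<and>
       (\<forall>n. \<forall>i<q n. a n i \<noteq> 0 \<longrightarrow> eq_mod_null M ((T ^^ h n) ` FF n i) (W n i 0)) \<and>
       (\<forall>n i. Suc i < q n \<and> a n i = 0 \<longrightarrow>
          eq_mod_null M ((T ^^ h n) ` FF n i) (FF n (Suc i))) \<and>
       (\<forall>n. \<forall>i<q n. \<forall>j. Suc j < a n i \<longrightarrow> eq_mod_null M (T ` W n i j) (W n i (Suc j))) \<and>
       (\<forall>n i. Suc i < q n \<and> a n i \<noteq> 0 \<longrightarrow>
          eq_mod_null M (T ` W n i (a n i - 1)) (FF n (Suc i))) \<and>
       (\<forall>n. eq_mod_null M (F (Suc n)) (FF n 0)) \<and>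
       (\<forall>n. refines_mod_null M (P (Suc n)) (P n)) \<and>
       generates_mod_null M (\<Union>n. P n))"

definition rank_one_system :: "'a measure \<Rightarrow> ('a \<Rightarrow> 'a) \<Rightarrow> bool" where
  "rank_one_system M T \<longleftrightarrow>
     measure_preserving_system M T \<and> (\<exists>q a F FF W. rank_one_construction M T q a F FF W)"

definition iterate_int :: "'a measure \<Rightarrow> ('a \<Rightarrow> 'a) \<Rightarrow> int \<Rightarrow> 'a \<Rightarrow> 'a" where
  "iterate_int M T k =
     (if k \<ge> 0 then T ^^ nat k else inv_into (space M) T ^^ nat (- k))"

definition essentially_0_expansive ::
  "'a measure \<Rightarrow> ('a \<Rightarrow> 'a) \<Rightarrow> (nat \<Rightarrow> 'a set) \<Rightarrow> bool" where
  "essentially_0_expansive M T F \<longleftrightarrow>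
     generates_mod_null M (range (\<lambda>k::int. iterate_int M T k ` F 0))"

end

theory Submission
  imports Defs
begin

text \<open>
  Fix a construction with towers over \<open>F n\<close> and let \<open>R\<close> be the first return map to \<open>F 0\<close>.  Tower \<open>n\<close>
  consists of \<open>N n\<close> copies of \<open>F 0\<close> (and spacers), and \<open>R\<close> moves each copy to the next one, cyclically
  modulo \<open>N n\<close>: spacers are invisible to \<open>R\<close>.  The return time to \<open>F 0\<close> depends only on the
  copy, except on the last one.  So the sequence of return times along an orbit is \<open>N n\<close>-periodic
  outside one residue class, the one that records the visits to \<open>F n\<close>.  If a second residue class
  were possible, then both classes together would force the return times to be
  \<open>N n\<close>-periodic.  Hence either \<open>F n\<close> can be read off from the \<open>F 0\<close>-name of a point, for
  every \<open>n\<close>, and the construction is essentially 0-expansive, or the return time to \<open>F n\<close> is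
  constant for some \<open>n\<close> and the system is an odometer up to a relabelling of the towers.

  In the second case the system itself carries another construction: along a sparse sequence of stages,
  declare the topmost copy of each tower in the next tower to be spacers.  By the Borel--Cantelli lemma almost
  every point is affected only finitely often, so the new towers still generate.  Their bases
  have two different return times, so the first alternative holds for them.
\<close>

section \<open>Visits to the base of a tower\<close>

text \<open>Height inside tower \<open>n + 1\<close> at which its \<open>i\<close>-th copy of tower
  \<open>n\<close> begins; \<open>i = q n\<close> gives the full height.\<close>

definition column_offset :: "(nat \<Rightarrow> nat) \<Rightarrow> (nat \<Rightarrow> nat \<Rightarrow> nat) \<Rightarrow> nat \<Rightarrow> nat \<Rightarrow> nat" where
  "column_offset q a n i = i * tower_height q a n + (\<Sum>j<i. a n j)"

text \<open>The number of levels of tower \<open>n\<close> that lie in \<open>F 0\<close>: the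
  height recursion with all spacers dropped.\<close>

definition copy_count :: "(nat \<Rightarrow> nat) \<Rightarrow> nat \<Rightarrow> nat" where
  "copy_count q n = (\<Prod>m<n. q m)"

text \<open>The height, in tower \<open>n\<close>, of its \<open>j\<close>-th level inside \<open>F 0\<close>, for \<open>j < copy_count q n\<close>.\<close>

primrec copy_offset :: "(nat \<Rightarrow> nat) \<Rightarrow> (nat \<Rightarrow> nat \<Rightarrow> nat) \<Rightarrow> nat \<Rightarrow> nat \<Rightarrow> nat" where
  "copy_offset q a 0 j = 0"
| "copy_offset q a (Suc n) j =
     column_offset q a n (j div copy_count q n) + copy_offset q a n (j mod copy_count q n)"

text \<open>Meaningful only at points that do return; lemma \<open>return\<close> guarantees this on
  the base of a \<open>cut_stack\<close>.\<close>

definition return_time :: "('a \<Rightarrow> 'a) \<Rightarrow> 'a set \<Rightarrow> 'a \<Rightarrow> nat" where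
  "return_time T B x = (LEAST t. 0 < t \<and> (T ^^ t) x \<in> B)"

definition return_map :: "('a \<Rightarrow> 'a) \<Rightarrow> 'a set \<Rightarrow> 'a \<Rightarrow> 'a" where
  "return_map T B x = (T ^^ return_time T B x) x"

text \<open>A test on the itinerary of \<open>x\<close>. The indices congruent to
  \<open>m - 1\<close> modulo \<open>m\<close> are exempt: there a block ends and spacers of later
  stages may come in. Only \<open>T\<close> and \<open>B\<close> enter, so the outcome can be read
  off from the \<open>B\<close>-name of \<open>x\<close>.\<close>

definition returns_as :: "('a \<Rightarrow> 'a) \<Rightarrow> 'a set \<Rightarrow> nat \<Rightarrow> (nat \<Rightarrow> nat) \<Rightarrow> 'a \<Rightarrow> bool" where
  "returns_as T B m f x \<longleftrightarrow> (\<forall>i. \<not> m dvd Suc i \<longrightarrow>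
     return_time T B ((return_map T B ^^ i) x) = f (Suc (i mod m)) - f (i mod m))"

section \<open>Iterates and column arithmetic\<close>

lemma funpow_image_image: "(f ^^ m) ` ((f ^^ n) ` A) = (f ^^ (m + n)) ` A"
  by (auto simp: funpow_add image_iff)

lemma funpow_cancel:
  assumes "bij_betw f E E" "x \<in> E" "y \<in> E" "(f ^^ m) x = (f ^^ n) y" "m \<le> n"
  shows "x = (f ^^ (n - m)) y"
proof -
  have b: "bij_betw (f ^^ i) E E" for i using assms(1) by (rule bij_betw_funpow)
  have "(f ^^ m) x = (f ^^ m) ((f ^^ (n - m)) y)"
    using assms(4,5) funpow_add[of m "n - m" f] by simp
  moreover have "(f ^^ (n - m)) y \<in> E" using b assms(3) by (meson bij_betwE)
  ultimately show ?thesis using b[of m] assms(2) by (meson bij_betw_imp_inj_on inj_onD)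
qed

lemma column_offset_0 [simp]: "column_offset q a n 0 = 0"
  by (simp add: column_offset_def)

lemma column_offset_Suc:
  "column_offset q a n (Suc i) = column_offset q a n i + tower_height q a n + a n i"
  by (simp add: column_offset_def)

lemma column_offset_top: "column_offset q a n (q n) = tower_height q a (Suc n)"
  by (simp add: column_offset_def)

lemma column_offset_mono: "i \<le> j \<Longrightarrow> column_offset q a n i \<le> column_offset q a n j"
  by (rule lift_Suc_mono_le[of "column_offset q a n"]) (auto simp: column_offset_Suc)

lemma column_offset_less:
  assumes "i < j"
  shows "column_offset q a n i + tower_height q a n + a n i \<le> column_offset q a n j"
  using column_offset_mono[of "Suc i" j q a n] assms by (simp add: column_offset_Suc)

lemma column_offset_height:
  assumes "i < q n"
  shows "column_offset q a n i + tower_height q a n + a n i \<le> tower_height q a (Suc n)"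
  using column_offset_less[OF assms, of q a n] by (simp add: column_offset_top)

lemma copy_count_Suc: "copy_count q (Suc n) = q n * copy_count q n"
  by (simp add: copy_count_def)

lemma copy_count_0 [simp]: "copy_count q 0 = 1"
  by (simp add: copy_count_def)

lemma copy_count_dvd: "m \<le> n \<Longrightarrow> copy_count q m dvd copy_count q n"
  by (induction rule: dec_induct) (auto simp: copy_count_Suc)

text \<open>Pointwise form of a construction, with all exceptional null sets moved outside the
  invariant set \<open>E\<close>. Only the bases are kept: pieces and spacers are levels whose
  heights are fixed by \<open>column_offset\<close>.\<close>

locale towers =
  fixes T :: "'a \<Rightarrow> 'a" and E :: "'a set" and q :: "nat \<Rightarrow> nat" and a :: "nat \<Rightarrow> nat \<Rightarrow> nat"
    and H :: "nat \<Rightarrow> 'a set"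
  assumes bij: "bij_betw T E E"
    and H_subset: "H n \<subseteq> E"
    and q_pos: "q n > 0"
    and cut: "H n = (\<Union>i<q n. (T ^^ column_offset q a n i) ` H (Suc n))"
    and disj: "\<lbrakk>z \<in> H n; z' \<in> H n; k < tower_height q a n; l < tower_height q a n;
                (T ^^ k) z = (T ^^ l) z'\<rbrakk> \<Longrightarrow> k = l"
begin

abbreviation "h \<equiv> tower_height q a"
abbreviation "c \<equiv> column_offset q a"
abbreviation "N \<equiv> copy_count q"
abbreviation "k \<equiv> copy_offset q a"
lemma N_pos: "N n > 0"
  using q_pos by (simp add: copy_count_def prod_pos)

lemma funpow_in_E: "x \<in> E \<Longrightarrow> (T ^^ i) x \<in> E"
  using bij_betw_funpow[OF bij] by (meson bij_betwE)

lemma H_in_E: "x \<in> H n \<Longrightarrow> x \<in> E"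
  using H_subset by auto

lemma cancel: "\<lbrakk>x \<in> E; y \<in> E; (T ^^ m) x = (T ^^ n) y; m \<le> n\<rbrakk> \<Longrightarrow> x = (T ^^ (n - m)) y"
  by (rule funpow_cancel[OF bij])

lemma copy_offset_less: "j < N n \<Longrightarrow> k n j < h n"
proof (induction n arbitrary: j)
  case (Suc n)
  have i: "j div N n < q n" using Suc.prems by (simp add: copy_count_Suc less_mult_imp_div_less)
  have "k n (j mod N n) < h n" using Suc.IH N_pos by simp
  then show ?case using column_offset_height[of "j div N n" q n a, OF i] by simp
qed simp

lemma copy_offset_strict_mono: "\<lbrakk>i < j; j < N n\<rbrakk> \<Longrightarrow> k n i < k n j"
proof (induction n arbitrary: i j)
  case (Suc n)
  show ?case
  proof (cases "i div N n = j div N n")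
    case True
    then have "i mod N n < j mod N n"
      using Suc.prems(1) by (metis div_mult_mod_eq nat_add_left_cancel_less)
    then have "k n (i mod N n) < k n (j mod N n)" using Suc.IH N_pos by simp
    then show ?thesis using True by simp
  next
    case False
    then have "i div N n < j div N n" using Suc.prems(1) by (simp add: div_le_mono le_neq_implies_less)
    then have "c n (i div N n) + h n \<le> c n (j div N n)"
      using column_offset_less[of "i div N n" "j div N n" q a n] by simp
    moreover have "k n (i mod N n) < h n" using copy_offset_less N_pos by simp
    ultimately show ?thesis by simp
  qed
qed simp

lemma copy_offset_0 [simp]: "k n 0 = 0"
  by (induction n) auto

lemma H_Suc_subset: "H (Suc n) \<subseteq> H n"
  using cut[of n] q_pos[of n] by force

lemma H_antimono: "m \<le> n \<Longrightarrow> H n \<subseteq> H m"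
  by (rule lift_Suc_antimono_le[of H]) (rule H_Suc_subset)

text \<open>Unfolding \<open>cut\<close> stage by stage. A copy in tower \<open>n + 1\<close> is
  addressed in mixed radix: the quotient by \<open>N n\<close> is the column, the remainder the copy
  within that column.\<close>

lemma base_copies: "H 0 = (\<Union>j<N n. (T ^^ k n j) ` H n)"
proof (induction n)
  case 0
  show ?case by (simp add: lessThan_Suc)
next
  case (Suc n)
  have "(\<Union>j<N n. (T ^^ k n j) ` H n) = (\<Union>j<N (Suc n). (T ^^ k (Suc n) j) ` H (Suc n))" (is "?L = ?R")
  proof (intro equalityI subsetI)
    fix x assume "x \<in> ?L"
    then obtain j y where j: "j < N n" "y \<in> H n" "x = (T ^^ k n j) y" by auto
    from j(2) obtain i z where i: "i < q n" "z \<in> H (Suc n)" "y = (T ^^ c n i) z" by (subst (asm) cut) auto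
    let ?j = "i * N n + j"
    have "?j < Suc i * N n" using j(1) by simp
    also have "\<dots> \<le> N (Suc n)" unfolding copy_count_Suc using i(1) by (intro mult_right_mono) auto
    finally have "?j < N (Suc n)" .
    moreover have "x = (T ^^ k (Suc n) ?j) z"
      using j i by (simp add: add.commute[of "c n i"] funpow_add)
    ultimately show "x \<in> ?R" using i(2) by blast
  next
    fix x assume "x \<in> ?R"
    then obtain j z where j: "j < N (Suc n)" "z \<in> H (Suc n)" "x = (T ^^ k (Suc n) j) z" by auto
    have "j div N n < q n" using j(1) by (simp add: copy_count_Suc less_mult_imp_div_less)
    then have "(T ^^ c n (j div N n)) z \<in> H n" using j(2) by (subst cut) auto
    moreover have "x = (T ^^ k n (j mod N n)) ((T ^^ c n (j div N n)) z)"
      using j(3) by (simp add: add.commute[of "c n _"] funpow_add)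
    moreover have "j mod N n < N n" using N_pos by simp
    ultimately show "x \<in> ?L" by blast
  qed
  then show ?case using Suc by simp
qed

lemma N_le_h: "N n \<le> h n"
  by (induction n) (simp_all add: copy_count_Suc trans_le_add1)

text \<open>\<open>N\<close> never decreases, each stage with \<open>q l > 1\<close> increases it
  strictly, and infinitely many such stages occur.\<close>

lemma copy_count_unbounded:
  assumes "infinite {n. q n > 1}"
  shows "\<exists>m\<ge>n. b \<le> N m"
proof (induction b)
  case (Suc b)
  then obtain m where m: "m \<ge> n" "b \<le> N m" by blast
  obtain l where l: "l \<ge> m" "q l > 1" using assms infinite_nat_iff_unbounded_le[of "{n. q n > 1}"] by auto
  have "N m \<le> N l" using copy_count_dvd[OF l(1)] N_pos by (rule dvd_imp_le)
  moreover have "N l < q l * N l" using l(2) N_pos[of l] by simp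
  ultimately have "b < q l * N l" using m(2) by linarith
  then show ?case using m l by (intro exI[of _ "Suc l"]) (auto simp: copy_count_Suc)
qed auto

text \<open>Used to discard a further null set by shrinking \<open>E\<close>; injectivity of the
  iterates lets images commute with intersection with \<open>E'\<close>.\<close>

lemma towers_restrict:
  assumes "bij_betw T E' E'" "E' \<subseteq> E"
  shows "towers T E' q a (\<lambda>n. H n \<inter> E')"
proof
  show "bij_betw T E' E'" by fact
  show "H n \<inter> E' \<subseteq> E'" "q n > 0" for n using q_pos by auto
  show "H n \<inter> E' = (\<Union>i<q n. (T ^^ column_offset q a n i) ` (H (Suc n) \<inter> E'))" for n
  proof -
    have "(T ^^ t) ` (H (Suc n) \<inter> E') = (T ^^ t) ` H (Suc n) \<inter> E'" for t
    proof -
      have "(T ^^ t) ` E' = E'" using bij_betw_funpow[OF assms(1)] by (simp add: bij_betw_def)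
      moreover have "inj_on (T ^^ t) E" using bij_betw_funpow[OF bij] by (simp add: bij_betw_def)
      ultimately show ?thesis using inj_on_image_Int[of "T ^^ t" E "H (Suc n)" E'] H_subset assms(2) by simp
    qed
    then show ?thesis by (subst cut) auto
  qed
next
  fix z z' n k l
  assume "z \<in> H n \<inter> E'" "z' \<in> H n \<inter> E'" "k < h n" "l < h n" "(T ^^ k) z = (T ^^ l) z'"
  then show "k = l" using disj by blast
qed

end

text \<open>The extra assumption excludes points that sit in the last copy of every late tower,
  since tower \<open>m\<close> controls the return time only below its last copy.\<close>

locale cut_stack = towers +
  assumes below_last: "\<And>x n. x \<in> H 0 \<Longrightarrow>
          \<exists>m\<ge>n. \<exists>j. Suc j < copy_count q m \<and> x \<in> (T ^^ copy_offset q a m j) ` H m"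
begin

section \<open>The first return map to the bottom base\<close>

abbreviation "ret \<equiv> return_time T (H 0)"
abbreviation "R \<equiv> return_map T (H 0)"

definition copy_index :: "nat \<Rightarrow> 'a \<Rightarrow> nat" where
  "copy_index n x = (THE j. j < N n \<and> x \<in> (T ^^ k n j) ` H n)"

lemma copy_index_eqI:
  assumes "j < N n" "z \<in> H n" "x = (T ^^ k n j) z"
  shows "copy_index n x = j"
  unfolding copy_index_def
proof (rule the_equality)
  show "j < N n \<and> x \<in> (T ^^ k n j) ` H n" using assms by auto
next
  fix i assume i: "i < N n \<and> x \<in> (T ^^ k n i) ` H n"
  then obtain z' where z': "z' \<in> H n" "(T ^^ k n i) z' = (T ^^ k n j) z" using assms by auto
  have "k n i = k n j" using disj[OF z'(1) assms(2) _ _ z'(2)] copy_offset_less i assms(1) by blast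
  then show "i = j" using copy_offset_strict_mono[of i j n] copy_offset_strict_mono[of j i n] i assms(1)
    by (metis nat_neq_iff)
qed

lemma copy_indexE:
  assumes "x \<in> H 0"
  obtains z where "z \<in> H n" "x = (T ^^ k n (copy_index n x)) z" "copy_index n x < N n"
proof -
  from assms obtain j z where "j < N n" "z \<in> H n" "x = (T ^^ k n j) z"
    by (subst (asm) base_copies[of n]) auto
  with copy_index_eqI[OF this] show ?thesis using that by auto
qed

lemma copy_index_less: "x \<in> H 0 \<Longrightarrow> copy_index n x < N n"
  using copy_indexE by metis

lemma copy_index_eq_0_iff: "x \<in> H 0 \<Longrightarrow> copy_index n x = 0 \<longleftrightarrow> x \<in> H n"
  using copy_index_eqI[of 0 n x x] N_pos by (metis copy_indexE copy_offset_0 funpow_0)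

lemma in_base_iff:
  assumes "z \<in> H n" "t < h n"
  shows "(T ^^ t) z \<in> H 0 \<longleftrightarrow> (\<exists>j<N n. t = k n j)"
proof
  assume "(T ^^ t) z \<in> H 0"
  then obtain z' j where z': "z' \<in> H n" "(T ^^ t) z = (T ^^ k n j) z'" "j < N n"
    by (rule copy_indexE)
  then show "\<exists>j<N n. t = k n j" using disj[OF assms(1) z'(1) assms(2) copy_offset_less z'(2)] by auto
next
  assume "\<exists>j<N n. t = k n j"
  then show "(T ^^ t) z \<in> H 0" using assms(1) by (subst base_copies[of n]) auto
qed

text \<open>Tower \<open>n + 1\<close> is a stack of copies of tower \<open>n\<close>, so the copy
  index at stage \<open>n\<close> is the low part of the mixed-radix address.\<close>

lemma copy_index_mod_Suc:
  assumes "x \<in> H 0"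
  shows "copy_index n x = copy_index (Suc n) x mod N n"
proof -
  let ?j = "copy_index (Suc n) x"
  obtain z where z: "z \<in> H (Suc n)" "x = (T ^^ k (Suc n) ?j) z" "?j < N (Suc n)"
    using assms by (rule copy_indexE)
  have "?j div N n < q n" using z(3) by (simp add: copy_count_Suc less_mult_imp_div_less)
  then have "(T ^^ c n (?j div N n)) z \<in> H n" using z(1) by (subst cut) auto
  moreover have "x = (T ^^ k n (?j mod N n)) ((T ^^ c n (?j div N n)) z)"
    using z(2) by (simp add: add.commute[of "c n _"] funpow_add)
  ultimately show ?thesis using N_pos by (intro copy_index_eqI) auto
qed

lemma copy_index_mod:
  assumes "x \<in> H 0" "n \<le> m"
  shows "copy_index n x = copy_index m x mod N n"
  using assms(2)
proof (induction rule: dec_induct)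
  case base
  show ?case using copy_index_less[OF assms(1)] by simp
next
  case (step m)
  then show ?case using copy_index_mod_Suc[OF assms(1), of m] copy_count_dvd[of n m q]
    by (simp add: mod_mod_cancel)
qed

text \<open>Below height \<open>h n\<close> the visits to \<open>H 0\<close> are exactly the heights
  \<open>k n i\<close>, and these increase strictly with \<open>i\<close>, so nothing can come
  between two consecutive copies.\<close>

lemma return_time_step:
  assumes "x \<in> H 0" "Suc (copy_index n x) < N n"
  shows "ret x = k n (Suc (copy_index n x)) - k n (copy_index n x)"
    and "copy_index n (R x) = Suc (copy_index n x)" and "R x \<in> H 0"
proof -
  let ?j = "copy_index n x"
  obtain z where z: "z \<in> H n" "x = (T ^^ k n ?j) z" "?j < N n" using assms(1) by (rule copy_indexE)
  have less: "k n ?j < k n (Suc ?j)" using copy_offset_strict_mono assms(2) by simp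
  have shift: "(T ^^ t) x = (T ^^ (t + k n ?j)) z" for t by (subst z(2)) (simp add: funpow_add)
  have in0: "(T ^^ (k n (Suc ?j) - k n ?j)) x = (T ^^ k n (Suc ?j)) z" using less by (simp only: shift) simp
  have inH: "(T ^^ k n (Suc ?j)) z \<in> H 0"
    using in_base_iff[OF z(1) copy_offset_less] assms(2) by blast
  show r: "ret x = k n (Suc ?j) - k n ?j"
    unfolding return_time_def
  proof (rule Least_equality)
    show "0 < k n (Suc ?j) - k n ?j \<and> (T ^^ (k n (Suc ?j) - k n ?j)) x \<in> H 0"
      using less in0 inH by simp
  next
    fix t assume t: "0 < t \<and> (T ^^ t) x \<in> H 0"
    show "k n (Suc ?j) - k n ?j \<le> t"
    proof (rule ccontr)
      assume "\<not> ?thesis"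
      then have lt: "t + k n ?j < k n (Suc ?j)" by simp
      then have "t + k n ?j < h n" using copy_offset_less[OF assms(2)] by simp
      then obtain i where i: "i < N n" "t + k n ?j = k n i"
        using in_base_iff[OF z(1)] t shift by auto
      have "k n ?j < k n i" "k n i < k n (Suc ?j)" using i lt t by auto
      then show False
        by (metis assms(2) copy_offset_strict_mono i(1) less_SucE linorder_neqE_nat order_less_asym z(3))
    qed
  qed
  have "R x = (T ^^ k n (Suc ?j)) z" unfolding return_map_def r in0 ..
  then show "copy_index n (R x) = Suc ?j" "R x \<in> H 0"
    using copy_index_eqI[OF assms(2) z(1)] inH by auto
qed

lemma return:
  assumes "x \<in> H 0"
  shows "ret x > 0" "R x \<in> H 0"
proof -
  obtain m j z where m: "Suc j < N m" "z \<in> H m" "x = (T ^^ k m j) z"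
    using below_last[OF assms, of 0] by blast
  then have j: "copy_index m x = j" using copy_index_eqI by simp
  show "R x \<in> H 0" using return_time_step[OF assms] m(1) j by metis
  show "ret x > 0" using return_time_step(1)[OF assms, of m] m(1) j copy_offset_strict_mono[of j "Suc j" m]
    by simp
qed

lemma return_time_le: "\<lbrakk>0 < t; (T ^^ t) x \<in> H 0\<rbrakk> \<Longrightarrow> ret x \<le> t"
  unfolding return_time_def by (rule Least_le) simp

text \<open>Spacers are invisible: an orbit leaving the last copy of tower \<open>n\<close> can
  re-enter \<open>H 0\<close> only through a bottom copy. Entering a higher copy would mean that the
  base below it, itself part of \<open>H 0\<close>, had been crossed earlier, against minimality of
  the return time.\<close>

lemma copy_index_return:
  assumes "x \<in> H 0"
  shows "copy_index n (R x) = Suc (copy_index n x) mod N n"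
proof (cases "Suc (copy_index n x) < N n")
  case True
  then show ?thesis using return_time_step[OF assms] by simp
next
  case False
  let ?j = "copy_index n x"
  obtain z where z: "z \<in> H n" "x = (T ^^ k n ?j) z" "?j < N n" using assms by (rule copy_indexE)
  have j: "Suc ?j = N n" using False z(3) by simp
  have Rx: "R x \<in> H 0" using return[OF assms] by simp
  then obtain w where w: "w \<in> H n" "R x = (T ^^ k n (copy_index n (R x))) w" "copy_index n (R x) < N n"
    by (rule copy_indexE)
  let ?i = "copy_index n (R x)" and ?s = "ret x + k n ?j"
  have shift: "(T ^^ t) x = (T ^^ (t + k n ?j)) z" for t by (subst z(2)) (simp add: funpow_add)
  have s: "R x = (T ^^ ?s) z" by (simp add: return_map_def shift)
  \<comment> \<open>No copy lies above copy \<open>N n - 1\<close>, so the return must happen at or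
    beyond the top of this tower.\<close>
  have hs: "h n \<le> ?s"
  proof (rule ccontr)
    assume "\<not> h n \<le> ?s"
    then obtain l where l: "l < N n" "?s = k n l" using in_base_iff[OF z(1)] Rx s by auto
    have "k n ?j < k n l" using l return(1)[OF assms] by simp
    then show False using copy_offset_strict_mono[of l ?j n] l j by (metis less_SucE nat_neq_iff order_less_asym z(3))
  qed
  have "?i = 0"
  proof (rule ccontr)
    assume "?i \<noteq> 0"
    then have ki: "0 < k n ?i" using copy_offset_strict_mono[of 0 ?i n] w(3) by simp
    have kh: "k n ?i < h n" using copy_offset_less w(3) by simp
    \<comment> \<open>\<open>w\<close> is the base point under the landing copy, and
      \<open>?u\<close> is the time at which the orbit of \<open>z\<close> meets it.\<close>
    let ?u = "?s - k n ?i"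
    have u: "w = (T ^^ ?u) z"
      using cancel[OF H_in_E[OF w(1)] H_in_E[OF z(1)], of "k n ?i" ?s] w(2) s kh hs by simp
    have w0: "w \<in> H 0" using w(1) H_antimono by blast
    show False
    proof (cases "?u > k n ?j")
      case True
      then have "(T ^^ (?u - k n ?j)) x = w" unfolding shift using u by simp
      then have "ret x \<le> ?u - k n ?j" using return_time_le[of "?u - k n ?j" x] True w0 by simp
      then show False using ki True by simp
    next
      case False
      then have "?u < h n" using copy_offset_less[OF z(3)] by simp
      \<comment> \<open>A base point cannot come back to \<open>H n\<close> after a positive time
        below \<open>h n\<close>, because the levels are disjoint.\<close>
      then have "?u = 0" using disj[OF z(1) w(1), of ?u 0] u by simp
      then show False using kh hs by simp
    qed
  qed
  then show ?thesis using j by simp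
qed

lemma return_funpow:
  assumes "x \<in> H 0"
  shows "(R ^^ i) x \<in> H 0" "copy_index n ((R ^^ i) x) = (copy_index n x + i) mod N n"
proof (induction i)
  case 0
  show "(R ^^ 0) x \<in> H 0" "copy_index n ((R ^^ 0) x) = (copy_index n x + 0) mod N n"
    using assms copy_index_less[OF assms] by simp_all
next
  case (Suc i)
  show "(R ^^ Suc i) x \<in> H 0" using Suc return by simp
  show "copy_index n ((R ^^ Suc i) x) = (copy_index n x + Suc i) mod N n"
    using Suc copy_index_return[of "(R ^^ i) x" n] by (simp add: mod_Suc_eq)
qed

lemma return_funpow_eq: "(R ^^ i) x = (T ^^ (\<Sum>j<i. ret ((R ^^ j) x))) x"
proof (induction i)
  case (Suc i)
  have "(R ^^ Suc i) x = (T ^^ ret ((R ^^ i) x)) ((R ^^ i) x)" by (simp add: return_map_def)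
  also have "\<dots> = (T ^^ (ret ((R ^^ i) x) + (\<Sum>j<i. ret ((R ^^ j) x)))) x"
    by (simp only: Suc funpow_add o_apply)
  finally show ?case by (simp add: add.commute)
qed simp

text \<open>Peeling off the first return leaves a shorter visit time, so strong induction on
  \<open>t\<close> applies.\<close>

lemma visit_is_return:
  assumes "x \<in> H 0" "(T ^^ t) x \<in> H 0"
  shows "\<exists>j. t = (\<Sum>i<j. ret ((R ^^ i) x))"
  using assms
proof (induction t arbitrary: x rule: less_induct)
  case (less t)
  show ?case
  proof (cases "t = 0")
    case True
    then show ?thesis by (intro exI[of _ 0]) simp
  next
    case False
    then have le: "ret x \<le> t" using return_time_le less.prems by simp
    have "(T ^^ t) x = (T ^^ (t - ret x)) (R x)"
      using le by (simp add: return_map_def flip: funpow_add[THEN fun_cong, simplified o_apply])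
    then obtain j where "t - ret x = (\<Sum>i<j. ret ((R ^^ i) (R x)))"
      using less.IH[of "t - ret x" "R x"] False le return[OF less.prems(1)] less.prems by auto
    then have "t = (\<Sum>i<Suc j. ret ((R ^^ i) x))"
      using le by (simp add: sum.lessThan_Suc_shift funpow_swap1 del: sum.lessThan_Suc)
    then show ?thesis by blast
  qed
qed

section \<open>Recognition of a base from return times\<close>

abbreviation "looks_like_start n x \<equiv> returns_as T (H 0) (N n) (k n) x"

lemma not_dvd_Suc: "\<not> N n dvd Suc i \<longleftrightarrow> Suc (i mod N n) < N n"
  using mod_Suc[of i "N n"] N_pos[of n] mod_less_divisor[of "N n" i]
  by (metis Suc_lessI less_irrefl mod_eq_0_iff_dvd nat.distinct(1))

text \<open>Starting in \<open>H n\<close>, the point \<open>(R ^^ i) x\<close> lies in copy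
  \<open>i mod N n\<close>, whose return time is fixed unless that copy is the last one.\<close>

lemma H_looks_like_start:
  assumes "x \<in> H n"
  shows "looks_like_start n x"
proof -
  have x: "x \<in> H 0" using assms H_antimono by blast
  have "copy_index n ((R ^^ i) x) = i mod N n" for i
    using return_funpow(2)[OF x, of n i] assms copy_index_eq_0_iff[OF x, of n] by simp
  then show ?thesis unfolding returns_as_def not_dvd_Suc
    using return_time_step(1)[of "(R ^^ _) x" n] return_funpow(1)[OF x] by simp
qed

text \<open>The towers leave the return time open only on the last copy. A point \<open>x\<close>
  outside \<open>H n\<close> that passes the test starts in a copy \<open>?s > 0\<close>, so the
  test exempts a different residue class and fixes the return time on the last copy too. Along the
  orbit of \<open>x\<close> return times then depend on the copy alone, and below the last copy of a
  high tower every \<open>y\<close> behaves like some point of that orbit.\<close>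

lemma unrecognized_imp_locally_constant:
  assumes "x \<in> H 0" "looks_like_start n x" "x \<notin> H n"
  shows "\<exists>\<kappa>. \<forall>y\<in>H 0. ret y = \<kappa> (copy_index n y)"
proof -
  let ?s = "copy_index n x" and ?\<rho> = "\<lambda>j. k n (Suc j) - k n j"
  \<comment> \<open>The orbit of \<open>x\<close> is in the last copy exactly at the indices
    \<open>i\<close> with \<open>i mod N n = N n - Suc ?s\<close>; the value prescribed there by the
    test is used.\<close>
  define \<kappa> where "\<kappa> = (\<lambda>j. if Suc j = N n then ?\<rho> (N n - Suc ?s) else ?\<rho> j)"
  have s: "0 < ?s" "?s < N n" using assms copy_index_eq_0_iff copy_index_less by auto
  have along: "ret ((R ^^ i) x) = \<kappa> (copy_index n ((R ^^ i) x))" for i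
  proof (cases "Suc (copy_index n ((R ^^ i) x)) = N n")
    case False
    then have "Suc (copy_index n ((R ^^ i) x)) < N n"
      using copy_index_less[OF return_funpow(1)[OF assms(1)], of n i] by simp
    then show ?thesis unfolding \<kappa>_def using return_time_step(1) return_funpow(1)[OF assms(1)] by simp
  next
    case True
    then have f: "Suc ((?s + i) mod N n) = N n" using return_funpow(2)[OF assms(1)] by simp
    have arith: "r = N n - Suc ?s"
      if "v = (if ?s + r < N n then ?s + r else ?s + r - N n)" "Suc v = N n" "r < N n" for r v
      using that s by (auto split: if_splits)
    have im: "i mod N n < N n" using N_pos by simp
    have wrap: "?s + i mod N n - N n < N n" using im s by linarith
    have "(?s + i) mod N n = (?s + i mod N n) mod N n" by (simp add: mod_add_right_eq)
    also have "\<dots> = (if ?s + i mod N n < N n then ?s + i mod N n else ?s + i mod N n - N n)"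
      using mod_less[OF wrap] le_mod_geq[of "N n" "?s + i mod N n"] by auto
    finally have "i mod N n = N n - Suc ?s" using f im by (rule arith)
    moreover from this have "\<not> N n dvd Suc i" unfolding not_dvd_Suc using s by simp
    ultimately show ?thesis using assms(2) True unfolding returns_as_def \<kappa>_def by auto
  qed
  have "ret y = \<kappa> (copy_index n y)" if y: "y \<in> H 0" for y
  proof -
    obtain m j where m: "m \<ge> n" "Suc j < N m" "copy_index m y = j"
      using below_last[OF y, of n] copy_index_eqI by (metis Suc_lessD imageE)
    \<comment> \<open>A number of returns that carries \<open>x\<close> from its own copy of tower
      \<open>m\<close> round, modulo \<open>N m\<close>, to copy \<open>j\<close>.\<close>
    define i where "i = j + (N m - copy_index m x)"
    have "copy_index m ((R ^^ i) x) = j"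
      using return_funpow(2)[OF assms(1), of m i] copy_index_less[OF assms(1), of m] m by (simp add: i_def)
    then have "ret y = ret ((R ^^ i) x)" "copy_index n y = copy_index n ((R ^^ i) x)"
      using return_time_step(1)[of y m] return_time_step(1)[of "(R ^^ i) x" m] copy_index_mod[of _ n m]
        return_funpow(1)[OF assms(1)] y m by auto
    then show ?thesis using along by simp
  qed
  then show ?thesis by blast
qed

section \<open>Constant return times\<close>

lemma sum_periodic: "(\<Sum>i<l * n. f (i mod n)) = l * (\<Sum>i<n. f i :: nat)" for n :: nat
proof (induction l)
  case (Suc l)
  have "(\<Sum>i<Suc l * n. f (i mod n)) = (\<Sum>i<l * n. f (i mod n)) + (\<Sum>i<n. f ((i + l * n) mod n))"
    using sum.atLeastLessThan_concat[of 0 "l * n" "Suc l * n" "\<lambda>i. f (i mod n)"]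
      sum.shift_bounds_nat_ivl[of "\<lambda>i. f (i mod n)" 0 "l * n" n]
    by (simp add: atLeast0LessThan)
  then show ?case using Suc by simp
qed simp

text \<open>Constancy of the return time to \<open>H m\<close> at every stage
  \<open>m \<ge> n\<close>, in the strong form that the visits are exactly the multiples of one
  number; \<open>p\<close> is the return time to \<open>H n\<close>. The nonempty base prevents
  vacuous truth.\<close>

definition periodic :: "nat \<Rightarrow> nat \<Rightarrow> bool" where
  "periodic n p \<longleftrightarrow> p > 0 \<and> H 0 \<noteq> {} \<and>
     (\<forall>m\<ge>n. \<forall>y\<in>H m. \<forall>t. (T ^^ t) y \<in> H m \<longleftrightarrow> p * (N m div N n) dvd t)"

text \<open>A cycle of \<open>N n\<close> returns meets each copy once and so takes the fixed time
  \<open>p\<close>; a cycle through tower \<open>m\<close> consists of \<open>N m div N n\<close>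
  such cycles.\<close>

lemma locally_constant_imp_periodic:
  assumes \<kappa>: "\<forall>y\<in>H 0. ret y = \<kappa> (copy_index n y)" and x: "x \<in> H 0"
  shows "\<exists>p. periodic n p"
proof -
  define p where "p = (\<Sum>j<N n. \<kappa> j)"
  have period: "(\<Sum>i<l * N m. ret ((R ^^ i) y)) = l * (p * (N m div N n))"
    if "m \<ge> n" "y \<in> H m" for m y l
  proof -
    have y: "y \<in> H 0" "y \<in> H n" using that H_antimono[of 0 m] H_antimono[of n m] by auto
    have "ret ((R ^^ i) y) = \<kappa> (i mod N n)" for i
      using \<kappa> return_funpow(1)[OF y(1)] return_funpow(2)[OF y(1), of n] copy_index_eq_0_iff[OF y(1), of n] y(2)
      by simp
    moreover have "(\<Sum>i<l * N m. \<kappa> (i mod N n)) = l * (N m div N n) * p"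
      using sum_periodic[where f = \<kappa> and l = "l * (N m div N n)" and n = "N n"]
        copy_count_dvd[OF that(1), of q] by (simp add: p_def mult.assoc)
    ultimately show ?thesis by simp
  qed
  have "(T ^^ t) y \<in> H m \<longleftrightarrow> p * (N m div N n) dvd t" if m: "m \<ge> n" and y: "y \<in> H m" for m y t
  proof
    have y0: "y \<in> H 0" using y H_antimono by blast
    {
      assume t: "(T ^^ t) y \<in> H m"
      then have t0: "(T ^^ t) y \<in> H 0" using H_antimono by blast
      obtain j where j: "t = (\<Sum>i<j. ret ((R ^^ i) y))" using visit_is_return[OF y0 t0] by blast
      then have "(R ^^ j) y \<in> H m" using t return_funpow_eq[of j y] by simp
      then have "N m dvd j"
        using return_funpow(2)[OF y0, of m j] copy_index_eq_0_iff return_funpow(1)[OF y0, of j] y y0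
        by (metis add_0 mod_eq_0_iff_dvd)
      then obtain l where "j = l * N m" by (metis dvd_div_mult_self)
      then show "p * (N m div N n) dvd t" using period[OF m y] j by simp
    next
      assume "p * (N m div N n) dvd t"
      then obtain l where "t = l * (p * (N m div N n))" by (metis dvd_div_mult_self)
      then have "(T ^^ t) y = (R ^^ (l * N m)) y" using period[OF m y] return_funpow_eq by metis
      moreover have "copy_index m ((R ^^ (l * N m)) y) = 0"
        using return_funpow(2)[OF y0, of m "l * N m"] copy_index_eq_0_iff[OF y0, of m] y by simp
      ultimately show "(T ^^ t) y \<in> H m" using copy_index_eq_0_iff return_funpow(1)[OF y0] by metis
    }
  qed
  moreover have "p > 0"
  proof -
    have "H n \<noteq> {}" using x base_copies[of n] by auto
    then obtain y where y: "y \<in> H n" by blast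
    then have "y \<in> H 0" using H_antimono by blast
    then have "(\<Sum>i<N n. ret ((R ^^ i) y)) > 0"
      using N_pos[of n] return(1) return_funpow(1) by (intro sum_pos) (auto simp: lessThan_empty_iff)
    then show ?thesis using period[of n y 1] y N_pos by simp
  qed
  ultimately show ?thesis unfolding periodic_def using x by blast
qed

text \<open>A base that the test fails to cut out yields an unrecognized point and, through it,
  periodicity.\<close>

lemma recognizable_or_periodic:
  "(\<forall>n. H n = {x \<in> H 0. looks_like_start n x}) \<or> (\<exists>n p. periodic n p)"
proof (rule disjCI)
  assume np: "\<nexists>n p. periodic n p"
  show "\<forall>n. H n = {x \<in> H 0. looks_like_start n x}"
  proof (intro allI equalityI subsetI)
    fix n x assume "x \<in> H n"
    then show "x \<in> {x \<in> H 0. looks_like_start n x}"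
      using H_looks_like_start H_antimono[of 0 n] by auto
  next
    fix n x assume x: "x \<in> {x \<in> H 0. looks_like_start n x}"
    show "x \<in> H n"
    proof (rule ccontr)
      assume "x \<notin> H n"
      then obtain \<kappa> where "\<forall>y\<in>H 0. ret y = \<kappa> (copy_index n y)"
        using unrecognized_imp_locally_constant[of x n] x by auto
      then show False using locally_constant_imp_periodic[of \<kappa> n x] np x by blast
    qed
  qed
qed

end

section \<open>Removing the topmost copies from odometer towers\<close>

text \<open>The periodic case along sparse stages: \<open>J k\<close> is the base at the
  \<open>k\<close>-th chosen stage, \<open>P k\<close> its constant return time, \<open>Q k\<close>
  the number of its copies in the next tower. Towers of height \<open>P k\<close> follow one another
  without gaps.\<close>

locale odometer_towers =
  fixes T :: "'a \<Rightarrow> 'a" and E :: "'a set" and J :: "nat \<Rightarrow> 'a set" and P Q :: "nat \<Rightarrow> nat"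
  assumes bij: "bij_betw T E E"
    and J_subset: "J k \<subseteq> E"
    and P_pos: "P k > 0"
    and P_Suc: "P (Suc k) = Q k * P k"
    and J_visit: "y \<in> J k \<Longrightarrow> (T ^^ t) y \<in> J k \<longleftrightarrow> P k dvd t"
    and J_cut: "J k \<subseteq> (\<Union>t<P (Suc k). (T ^^ t) ` J (Suc k))"
    and J_Suc_subset: "J (Suc k) \<subseteq> J k"
begin

lemma J_antimono: "k \<le> l \<Longrightarrow> J l \<subseteq> J k"
  by (rule lift_Suc_antimono_le[of J]) (rule J_Suc_subset)

lemma P_dvd: "k \<le> l \<Longrightarrow> P k dvd P l"
  by (induction rule: dec_induct) (auto simp: P_Suc)

lemma J_in_E: "y \<in> J k \<Longrightarrow> y \<in> E"
  using J_subset by auto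

text \<open>Climb one stage at a time: the base point at stage \<open>l\<close> sits in tower
  \<open>l + 1\<close> at a height that is a multiple of \<open>P l\<close>.\<close>

lemma J_address:
  assumes "k \<le> l" "y \<in> J k"
  shows "\<exists>z\<in>J l. \<exists>t<P l. P k dvd t \<and> y = (T ^^ t) z"
proof -
  have "\<exists>z\<in>J l. \<exists>t<P l. y = (T ^^ t) z"
    using assms(1)
  proof (induction rule: dec_induct)
    case base
    show ?case using assms(2) P_pos[of k] by (intro bexI[of _ y] exI[of _ 0]) auto
  next
    case (step l)
    then obtain z t where z: "z \<in> J l" "t < P l" "y = (T ^^ t) z" by blast
    obtain w s where w: "w \<in> J (Suc l)" "s < P (Suc l)" "z = (T ^^ s) w" using J_cut z(1) by blast
    have "w \<in> J l" using w(1) J_Suc_subset by blast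
    then have "P l dvd s" using J_visit z(1) w(3) by blast
    then obtain i where i: "s = i * P l" by (metis dvd_div_mult_self)
    \<comment> \<open>\<open>s\<close> is a multiple of \<open>P l\<close> below
      \<open>P (Suc l)\<close>, so a whole tower of height \<open>P l\<close> fits above it.\<close>
    then have "Suc i * P l \<le> P (Suc l)"
      using w(2) unfolding P_Suc by (intro mult_right_mono) auto
    then have "t + s < P (Suc l)" using z(2) i by simp
    then show ?case using w z(3) by (intro bexI[of _ w] exI[of _ "t + s"]) (auto simp: funpow_add)
  qed
  then obtain z t where z: "z \<in> J l" "t < P l" "y = (T ^^ t) z" by blast
  then have "P k dvd t" using J_visit[of z k t] J_antimono[OF assms(1)] assms(2) by blast
  then show ?thesis using z by blast
qed

text \<open>If \<open>s < t\<close>, the orbit of \<open>z\<close> would visit \<open>J k\<close> at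
  \<open>w\<close> after \<open>t - s\<close> steps, a positive time below
  \<open>P k\<close>.\<close>

lemma J_address_order:
  assumes "w \<in> J k" "z \<in> J k" "(T ^^ s) w = (T ^^ t) z" "t < P k"
  shows "t \<le> s" "z = (T ^^ (s - t)) w"
proof -
  show "t \<le> s"
  proof (rule ccontr)
    assume "\<not> t \<le> s"
    moreover from this have "w = (T ^^ (t - s)) z"
      using funpow_cancel[OF bij J_in_E[OF assms(1)] J_in_E[OF assms(2)] assms(3)] by simp
    then have "P k dvd t - s" using J_visit[OF assms(2)] assms(1) by simp
    ultimately show False using assms(4) by (auto dest: dvd_imp_le)
  qed
  then show "z = (T ^^ (s - t)) w"
    using funpow_cancel[OF bij J_in_E[OF assms(2)] J_in_E[OF assms(1)] assms(3)[symmetric]] by simp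
qed

lemma J_levels_disjoint:
  assumes "w \<in> J k" "z \<in> J k" "(T ^^ s) w = (T ^^ t) z" "s < P k" "t < P k"
  shows "s = t" "w = z"
proof -
  show "s = t" using J_address_order(1)[OF assms(1-3,5)] J_address_order(1)[OF assms(2,1) assms(3)[symmetric] assms(4)]
    by simp
  then show "w = z" using J_address_order(2)[OF assms(1-3,5)] by simp
qed

text \<open>Points of \<open>J k\<close> that never lie in the topmost copy of a tower \<open>l\<close> inside the tower
  \<open>l + 1\<close>, for \<open>l \<ge> k\<close>.\<close>

definition G :: "nat \<Rightarrow> 'a set" where
  "G k = J k \<inter> (\<Inter>l\<in>{k..}. \<Union>s<(Q l - 1) * P l. (T ^^ s) ` J (Suc l))"

text \<open>The part discarded at stage \<open>l\<close>: the upper \<open>P l\<close> levels of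
  tower \<open>l + 1\<close>.\<close>

definition top_copy :: "nat \<Rightarrow> 'a set" where
  "top_copy l = (\<Union>s<P l. (T ^^ ((Q l - 1) * P l + s)) ` J (Suc l))"

lemma G_subset_J: "G k \<subseteq> J k"
  by (auto simp: G_def)

lemma G_memI:
  assumes "y \<in> J k" "\<And>l. l \<ge> k \<Longrightarrow> \<exists>z\<in>J (Suc l). \<exists>s<(Q l - 1) * P l. y = (T ^^ s) z"
  shows "y \<in> G k"
  using assms unfolding G_def by blast

lemma G_memD:
  assumes "y \<in> G k" "l \<ge> k"
  shows "\<exists>z\<in>J (Suc l). \<exists>s<(Q l - 1) * P l. y = (T ^^ s) z"
  using assms unfolding G_def by blast

text \<open>The condition at stage \<open>k\<close> limits the column \<open>i\<close>. At later
  stages the conditions on \<open>y\<close> and on the base point \<open>z\<close> beneath it agree,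
  because both lie in the same copy of tower \<open>k + 1\<close>.\<close>

lemma G_cut: "G k = (\<Union>i<Q k - 1. (T ^^ (i * P k)) ` G (Suc k))"
proof (intro equalityI subsetI)
  fix y assume y: "y \<in> G k"
  obtain z s where z: "z \<in> J (Suc k)" "s < (Q k - 1) * P k" "y = (T ^^ s) z"
    using G_memD[OF y, of k] by blast
  have "P k dvd s" using J_visit[of z k s] z J_Suc_subset y G_subset_J by blast
  then obtain i where i: "s = i * P k" by (metis dvd_div_mult_self)
  then have "i < Q k - 1" using z(2) by simp
  have sP: "s < P (Suc k)"
    using less_le_trans[OF z(2) mult_right_mono[of "Q k - 1" "Q k" "P k"]] unfolding P_Suc by simp
  have "z \<in> G (Suc k)"
  proof (rule G_memI[OF z(1)])
    fix l assume l: "l \<ge> Suc k"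
    then obtain w s' where w: "w \<in> J (Suc l)" "s' < (Q l - 1) * P l" "y = (T ^^ s') w"
      using G_memD[OF y Suc_leD[OF l]] by blast
    have "w \<in> J (Suc k)" using w(1) J_antimono[of "Suc k" "Suc l"] l by auto
    then have "s \<le> s'" "z = (T ^^ (s' - s)) w"
      using J_address_order[OF _ z(1) _ sP, of w s'] w(3) z(3) by auto
    then show "\<exists>w\<in>J (Suc l). \<exists>s<(Q l - 1) * P l. z = (T ^^ s) w" using w(1,2)
      by (intro bexI[of _ w] exI[of _ "s' - s"]) auto
  qed
  then show "y \<in> (\<Union>i<Q k - 1. (T ^^ (i * P k)) ` G (Suc k))" using z(3) i \<open>i < Q k - 1\<close> by auto
next
  fix y assume "y \<in> (\<Union>i<Q k - 1. (T ^^ (i * P k)) ` G (Suc k))"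
  then obtain i z where i: "i < Q k - 1" "z \<in> G (Suc k)" "y = (T ^^ (i * P k)) z" by auto
  have zJ: "z \<in> J (Suc k)" "z \<in> J k" using i(2) G_subset_J J_Suc_subset by blast+
  show "y \<in> G k"
  proof (rule G_memI)
    show "y \<in> J k" using J_visit zJ(2) i(3) by simp
  next
    fix l assume "l \<ge> k"
    show "\<exists>z\<in>J (Suc l). \<exists>s<(Q l - 1) * P l. y = (T ^^ s) z"
    proof (cases "l = k")
      case True
      then show ?thesis using i zJ P_pos[of k] by (intro bexI[of _ z] exI[of _ "i * P k"]) auto
    next
      case False
      then have l: "Suc k \<le> l" using \<open>l \<ge> k\<close> by simp
      then obtain w s where w: "w \<in> J (Suc l)" "s < (Q l - 1) * P l" "z = (T ^^ s) w"
        using G_memD[OF i(2) l] by blast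
      have "w \<in> J (Suc k)" using w(1) J_antimono[of "Suc k" "Suc l"] l by auto
      then have "P (Suc k) dvd s" using J_visit zJ(1) w(3) by blast
      \<comment> \<open>The room left below the top copy is a positive multiple of
        \<open>P (Suc k)\<close>, which exceeds \<open>i * P k\<close>.\<close>
      then have "P (Suc k) dvd (Q l - 1) * P l - s" using P_dvd[OF l] by simp
      then have "P (Suc k) \<le> (Q l - 1) * P l - s" using w(2) by (intro dvd_imp_le) auto
      moreover have "i * P k < P (Suc k)" unfolding P_Suc using i(1) P_pos[of k] by simp
      ultimately have "i * P k + s < (Q l - 1) * P l" by simp
      then show ?thesis using w(1,3) i(3)
        by (intro bexI[of _ w] exI[of _ "i * P k + s"]) (auto simp: funpow_add)
    qed
  qed
qed

text \<open>From stage \<open>m\<close> on, \<open>y\<close> stays below the top copies; the base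
  point \<open>z\<close> of its tower is at no greater height in any later tower, hence below them
  as well.\<close>

lemma J_eventually_G:
  assumes y: "y \<in> J k" and l0: "k \<le> m" and avoid: "\<And>l. l \<ge> m \<Longrightarrow> y \<notin> top_copy l"
  shows "\<exists>t<P m. P k dvd t \<and> y \<in> (T ^^ t) ` G m"
proof -
  obtain z t where z: "z \<in> J m" "t < P m" "P k dvd t" "y = (T ^^ t) z"
    using J_address[OF l0 y] by blast
  have "z \<in> G m"
  proof (rule G_memI[OF z(1)])
    fix l assume l: "l \<ge> m"
    obtain w s where w: "w \<in> J (Suc l)" "s < P (Suc l)" "y = (T ^^ s) w"
      using J_address[of k "Suc l", OF _ y] l l0 by auto
    have s: "s < (Q l - 1) * P l"
    proof (rule ccontr)
      assume s: "\<not> ?thesis"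
      define r where "r = s - (Q l - 1) * P l"
      have "y = (T ^^ ((Q l - 1) * P l + r)) w" using s w(3) by (simp add: r_def)
      moreover have "r < P l" using w(2) s unfolding P_Suc r_def by (cases "Q l") auto
      ultimately have "y \<in> top_copy l" using w(1) unfolding top_copy_def by blast
      then show False using avoid l by blast
    qed
    have "w \<in> J m" using w(1) J_antimono[of m "Suc l"] l by auto
    then have "t \<le> s" "z = (T ^^ (s - t)) w"
      using J_address_order[OF _ z(1) _ z(2), of w s] w(3) z(4) by auto
    then show "\<exists>w\<in>J (Suc l). \<exists>s<(Q l - 1) * P l. z = (T ^^ s) w" using w(1) s
      by (intro bexI[of _ w] exI[of _ "s - t"]) auto
  qed
  then show ?thesis using z by blast
qed

text \<open>The omitted visit that later rules out periodicity of the new bases.\<close>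

lemma G_avoids_top_copy:
  assumes "z \<in> G (Suc k)" "Q k \<ge> 2"
  shows "(T ^^ ((Q k - 1) * P k)) z \<notin> G k"
proof
  assume "(T ^^ ((Q k - 1) * P k)) z \<in> G k"
  then obtain w s where w: "w \<in> J (Suc k)" "s < (Q k - 1) * P k" "(T ^^ ((Q k - 1) * P k)) z = (T ^^ s) w"
    using G_memD[of _ k k] by blast
  have "(Q k - 1) * P k < P (Suc k)" "s < P (Suc k)"
    using w(2) assms(2) P_pos[of k] unfolding P_Suc by (auto simp: diff_mult_distrib)
  then have "(Q k - 1) * P k = s" using J_levels_disjoint(1)[OF _ w(1,3)] assms(1) G_subset_J by blast
  then show False using w(2) by simp
qed

end

text \<open>Stage 0 only serves to pass from the required initial height 1 to \<open>P 0\<close>; stage \<open>k + 1\<close>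
  replaces the topmost of \<open>Q k\<close> copies by \<open>P k\<close> spacers.\<close>

fun gap_cuts :: "(nat \<Rightarrow> nat) \<Rightarrow> nat \<Rightarrow> nat" where
  "gap_cuts Q 0 = 1"
| "gap_cuts Q (Suc k) = Q k - 1"

fun gap_spacers :: "(nat \<Rightarrow> nat) \<Rightarrow> (nat \<Rightarrow> nat) \<Rightarrow> nat \<Rightarrow> nat \<Rightarrow> nat" where
  "gap_spacers P Q 0 i = P 0 - 1"
| "gap_spacers P Q (Suc k) i = (if Suc i = Q k - 1 then P k else 0)"

section \<open>Heights and columns of the new towers\<close>

context odometer_towers
begin

abbreviation "q' \<equiv> gap_cuts Q"
abbreviation "a' \<equiv> gap_spacers P Q"

text \<open>Index shift for the extra initial stage: by truncated subtraction both
  \<open>G' 0\<close> and \<open>G' 1\<close> are \<open>G 0\<close>.\<close>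

definition G' :: "nat \<Rightarrow> 'a set" where
  "G' n = G (n - 1)"

text \<open>Only the last kept column, with index \<open>Q k - 2\<close>, carries spacers.\<close>

lemma gap_spacers_sum:
  assumes "Q k \<ge> 2"
  shows "(\<Sum>i<Q k - 1. a' (Suc k) i) = P k"
proof -
  have "(\<Sum>i<Q k - 1. a' (Suc k) i) = (\<Sum>i\<in>{Q k - 2}. a' (Suc k) i)"
    using assms by (intro sum.mono_neutral_right) auto
  also have "\<dots> = P k" using assms by (simp add: Suc_diff_Suc numeral_2_eq_2)
  finally show ?thesis .
qed

text \<open>The \<open>P k\<close> spacers take the place of the discarded copy, so the height
  \<open>Q k * P k\<close> is preserved.\<close>

lemma gap_height:
  assumes "\<And>k. Q k \<ge> 2"
  shows "tower_height q' a' (Suc k) = P k"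
proof (induction k)
  case 0
  show ?case using P_pos[of 0] by simp
next
  case (Suc k)
  then show ?case using gap_spacers_sum[OF assms, of k] assms[of k]
    by (simp add: P_Suc diff_mult_distrib del: gap_spacers.simps)
qed

lemma gap_column:
  assumes "\<And>k. Q k \<ge> 2" "i < Q k - 1"
  shows "column_offset q' a' (Suc k) i = i * P k"
proof -
  have "(\<Sum>j<i. a' (Suc k) j) = 0" using assms(2) by (intro sum.neutral) auto
  then show ?thesis unfolding column_offset_def using gap_height[OF assms(1)] by simp
qed

lemma gap_cut:
  assumes "\<And>k. Q k \<ge> 2"
  shows "G' n = (\<Union>i<q' n. (T ^^ column_offset q' a' n i) ` G' (Suc n))"
proof (cases n)
  case 0
  then show ?thesis by (simp add: G'_def lessThan_Suc)
next
  case (Suc k)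
  then show ?thesis using G_cut[of k] gap_column[OF assms] by (simp add: G'_def)
qed

lemma gap_disjoint:
  assumes "\<And>k. Q k \<ge> 2"
    and "z \<in> G' n" "z' \<in> G' n" "k < tower_height q' a' n" "l < tower_height q' a' n"
      "(T ^^ k) z = (T ^^ l) z'"
  shows "k = l"
proof (cases n)
  case 0
  then show ?thesis using assms by simp
next
  case (Suc m)
  then have "z \<in> J m" "z' \<in> J m" using assms G_subset_J by (auto simp: G'_def)
  then show ?thesis using J_levels_disjoint(1) assms gap_height[OF assms(1)] Suc by metis
qed

end

section \<open>Sets modulo null sets\<close>

lemma eq_mod_null_refl [simp]: "eq_mod_null M A A"
  by (simp add: eq_mod_null_def)

lemma eq_mod_null_sym: "eq_mod_null M A B \<Longrightarrow> eq_mod_null M B A"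
  by (simp add: eq_mod_null_def Un_commute)

lemma eq_mod_nullI:
  assumes "A \<in> sets M" "B \<in> sets M" "Z \<in> null_sets M" "\<And>x. \<lbrakk>x \<in> space M; x \<notin> Z\<rbrakk> \<Longrightarrow> x \<in> A \<longleftrightarrow> x \<in> B"
  shows "eq_mod_null M A B"
  unfolding eq_mod_null_def
proof (rule null_sets_subset[OF assms(3)])
  show "sym_diff A B \<in> sets M" using assms by auto
  show "sym_diff A B \<subseteq> Z"
    using assms(4) assms(1,2)[THEN sets.sets_into_space] by blast
qed

lemma eq_mod_null_trans:
  assumes "A \<in> sets M" "C \<in> sets M" "eq_mod_null M A B" "eq_mod_null M B C"
  shows "eq_mod_null M A C"
proof (rule eq_mod_nullI[OF assms(1,2)])
  show "sym_diff A B \<union> sym_diff B C \<in> null_sets M"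
    using assms(3,4) unfolding eq_mod_null_def by (rule null_sets.Un)
qed blast

lemma eq_mod_null_UN:
  fixes I :: "'i::countable set"
  assumes "\<And>i. i \<in> I \<Longrightarrow> A i \<in> sets M" "\<And>i. i \<in> I \<Longrightarrow> B i \<in> sets M"
    "\<And>i. i \<in> I \<Longrightarrow> eq_mod_null M (A i) (B i)"
  shows "eq_mod_null M (\<Union>i\<in>I. A i) (\<Union>i\<in>I. B i)"
proof (rule eq_mod_nullI[where Z="\<Union>i\<in>I. sym_diff (A i) (B i)"])
  show "(\<Union>i\<in>I. sym_diff (A i) (B i)) \<in> null_sets M"
    using assms(3) by (intro null_sets_UN') (auto simp: eq_mod_null_def)
next
  show "(\<Union>i\<in>I. A i) \<in> sets M" "(\<Union>i\<in>I. B i) \<in> sets M"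
    using assms(1,2) by (auto intro!: sets.countable_UN'')
qed blast

text \<open>The measurable sets known, up to null sets, to the sigma-algebra generated by
  \<open>C\<close>. This family is closed under complements and countable unions, so generation can
  be checked on generators.\<close>

definition sets_mod_null :: "'a measure \<Rightarrow> 'a set set \<Rightarrow> 'a set set" where
  "sets_mod_null M C = {A \<in> sets M. \<exists>B\<in>sigma_sets (space M) C. eq_mod_null M A B}"

lemma sigma_sets_in_sets: "C \<subseteq> sets M \<Longrightarrow> sigma_sets (space M) C \<subseteq> sets M"
  by (rule sets.sigma_sets_subset)

lemma sets_mod_null_basic: "\<lbrakk>C \<subseteq> sets M; A \<in> C\<rbrakk> \<Longrightarrow> A \<in> sets_mod_null M C"
  unfolding sets_mod_null_def
  by (rule CollectI, intro conjI bexI[of _ A]) (auto intro: sigma_sets.Basic)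

lemma sets_mod_null_cong:
  assumes "C \<subseteq> sets M" "A \<in> sets M" "B \<in> sets_mod_null M C" "eq_mod_null M A B"
  shows "A \<in> sets_mod_null M C"
proof -
  obtain D where D: "D \<in> sigma_sets (space M) C" "eq_mod_null M B D"
    using assms(3) unfolding sets_mod_null_def by blast
  then have "eq_mod_null M A D"
    using sigma_sets_in_sets[OF assms(1)] by (intro eq_mod_null_trans[OF assms(2) _ assms(4)]) auto
  then show ?thesis using assms(2) D(1) unfolding sets_mod_null_def by blast
qed

lemma sets_mod_null_Diff:
  assumes "C \<subseteq> sets M" "A \<in> sets_mod_null M C"
  shows "space M - A \<in> sets_mod_null M C"
proof -
  obtain B where B: "B \<in> sigma_sets (space M) C" "eq_mod_null M A B" and A: "A \<in> sets M"
    using assms unfolding sets_mod_null_def by blast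
  have "B \<in> sets M" using B(1) sigma_sets_in_sets[OF assms(1)] by blast
  then have "eq_mod_null M (space M - A) (space M - B)"
    using A B(2) by (intro eq_mod_nullI[of _ _ _ "sym_diff A B"]) (auto simp: eq_mod_null_def)
  then show ?thesis using A B(1) unfolding sets_mod_null_def by (auto intro: sigma_sets.Compl)
qed

lemma sets_mod_null_UN:
  fixes I :: "nat set"
  assumes "C \<subseteq> sets M" "\<And>i. i \<in> I \<Longrightarrow> A i \<in> sets_mod_null M C"
  shows "(\<Union>i\<in>I. A i) \<in> sets_mod_null M C"
proof -
  have "\<forall>i\<in>I. \<exists>B. B \<in> sigma_sets (space M) C \<and> eq_mod_null M (A i) B" "\<forall>i\<in>I. A i \<in> sets M"
    using assms(2) unfolding sets_mod_null_def by auto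
  then obtain B where B: "\<forall>i\<in>I. B i \<in> sigma_sets (space M) C \<and> eq_mod_null M (A i) (B i)" and A: "\<forall>i\<in>I. A i \<in> sets M"
    by (metis (no_types))
  let ?B = "\<lambda>i. if i \<in> I then B i else {}"
  have "(\<Union>i. ?B i) \<in> sigma_sets (space M) C"
    using B by (intro sigma_sets.Union) (auto intro: sigma_sets.Empty)
  moreover have "(\<Union>i. ?B i) = (\<Union>i\<in>I. B i)" by (auto split: if_splits)
  moreover have "eq_mod_null M (\<Union>i\<in>I. A i) (\<Union>i\<in>I. B i)"
    using A B sigma_sets_in_sets[OF assms(1)] by (intro eq_mod_null_UN) auto
  ultimately show ?thesis using A unfolding sets_mod_null_def
    by (auto intro!: sets.countable_UN'')
qed

lemma sigma_sets_sets_mod_null: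
  assumes "C \<subseteq> sets M" "D \<subseteq> sets_mod_null M C" "A \<in> sigma_sets (space M) D"
  shows "A \<in> sets_mod_null M C"
  using assms(3)
proof induction
  case Empty
  show ?case using sets_mod_null_UN[OF assms(1), of "{}" "\<lambda>_. {}"] by simp
next
  case (Union A)
  then show ?case using sets_mod_null_UN[OF assms(1), of UNIV A] by simp
qed (use assms(2) sets_mod_null_Diff[OF assms(1)] in blast)+

lemma generates_mod_null_transfer:
  assumes "generates_mod_null M D" "C \<subseteq> sets M" "D \<subseteq> sets_mod_null M C"
  shows "generates_mod_null M C"
  unfolding generates_mod_null_def
proof (intro conjI ballI)
  fix A assume A: "A \<in> sets M"
  then obtain B where "B \<in> sigma_sets (space M) D" "eq_mod_null M A B"
    using assms(1) unfolding generates_mod_null_def by blast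
  then have "A \<in> sets_mod_null M C"
    using sets_mod_null_cong[OF assms(2) A] sigma_sets_sets_mod_null[OF assms(2,3)] by blast
  then show "\<exists>B\<in>sigma_sets (space M) C. eq_mod_null M A B" by (auto simp: sets_mod_null_def)
qed fact

lemma tower_partition_subset_sets_mod_null:
  assumes "C \<subseteq> sets M" "\<And>k. k < h \<Longrightarrow> (T ^^ k) ` B \<in> sets_mod_null M C"
  shows "tower_partition M T B h \<subseteq> sets_mod_null M C"
  unfolding tower_partition_def
  using assms(2) sets_mod_null_Diff[OF assms(1)] sets_mod_null_UN[OF assms(1), of "{..<h}" "\<lambda>k. (T ^^ k) ` B"]
  by auto

section \<open>Images and null sets in measure-preserving systems\<close>

locale mp_system = prob_space M for M :: "'a measure" +
  fixes T :: "'a \<Rightarrow> 'a"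
  assumes bij_T: "bij_betw T (space M) (space M)"
    and T_measurable: "T \<in> measurable M M"
    and T_inv_measurable: "inv_into (space M) T \<in> measurable M M"
    and distr_T: "distr M M T = M"
begin

abbreviation "T_inv \<equiv> inv_into (space M) T"

lemma T_inv_in: "x \<in> space M \<Longrightarrow> T_inv x \<in> space M"
  using bij_T by (metis bij_betw_def inv_into_into)

lemma T_T_inv: "x \<in> space M \<Longrightarrow> T (T_inv x) = x"
  using bij_T by (metis bij_betw_def f_inv_into_f)

lemma T_inv_T: "x \<in> space M \<Longrightarrow> T_inv (T x) = x"
  using bij_T by (metis bij_betw_def inv_into_f_f)

lemma T_in: "x \<in> space M \<Longrightarrow> T x \<in> space M"
  using bij_T by (meson bij_betwE)

lemma funpow_T_in: "x \<in> space M \<Longrightarrow> (T ^^ k) x \<in> space M"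
  by (induction k) (auto simp: T_in)

lemma bij_funpow_T: "bij_betw (T ^^ k) (space M) (space M)"
  using bij_T by (rule bij_betw_funpow)

lemma T_vimage_image: "B \<subseteq> space M \<Longrightarrow> T -` (T ` B) \<inter> space M = B"
  using bij_betw_imp_inj_on[OF bij_T] by (auto simp: inj_on_def)

lemma T_image_eq: "A \<subseteq> space M \<Longrightarrow> T ` A = T_inv -` A \<inter> space M"
proof (intro equalityI subsetI)
  fix x assume "A \<subseteq> space M" "x \<in> T_inv -` A \<inter> space M"
  then show "x \<in> T ` A" using T_T_inv[of x] by (metis IntE image_eqI vimageE)
qed (use T_inv_T T_in in auto)

lemma T_image_sets: "A \<in> sets M \<Longrightarrow> T ` A \<in> sets M"
  using T_image_eq[of A] sets.sets_into_space[of A M] T_inv_measurable by (simp add: measurable_sets)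

lemma funpow_T_image_sets: "A \<in> sets M \<Longrightarrow> (T ^^ k) ` A \<in> sets M"
proof (induction k)
  case (Suc k)
  have "(T ^^ Suc k) ` A = T ` ((T ^^ k) ` A)" by (simp add: image_image)
  then show ?case using T_image_sets[OF Suc.IH[OF Suc.prems]] by simp
qed simp

lemma emeasure_T_vimage:
  assumes "A \<in> sets M"
  shows "emeasure M (T -` A \<inter> space M) = emeasure M A"
proof -
  have "emeasure (distr M M T) A = emeasure M (T -` A \<inter> space M)"
    using T_measurable assms by (rule emeasure_distr)
  then show ?thesis unfolding distr_T ..
qed

lemma emeasure_T_image: "A \<in> sets M \<Longrightarrow> emeasure M (T ` A) = emeasure M A"
  using emeasure_T_vimage[OF T_image_sets[of A]] T_vimage_image[OF sets.sets_into_space[of A M]] by simp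

lemma emeasure_funpow_T_image: "A \<in> sets M \<Longrightarrow> emeasure M ((T ^^ k) ` A) = emeasure M A"
proof (induction k)
  case (Suc k)
  have "(T ^^ Suc k) ` A = T ` ((T ^^ k) ` A)" by (simp add: image_image)
  then show ?case using Suc emeasure_T_image[OF funpow_T_image_sets[OF Suc.prems]] by simp
qed simp

lemma null_sets_funpow_T_image: "Z \<in> null_sets M \<Longrightarrow> (T ^^ k) ` Z \<in> null_sets M"
  using emeasure_funpow_T_image[of Z k] funpow_T_image_sets[of Z k]
  by (intro null_setsI) (simp_all add: null_setsD1 null_setsD2)

lemma null_sets_funpow_T_vimage:
  assumes "Z \<in> null_sets M"
  shows "(T ^^ k) -` Z \<inter> space M \<in> null_sets M"
proof (induction k)
  case 0
  have "(\<lambda>x. x) -` Z \<inter> space M = Z" using sets.sets_into_space[of Z M] assms by auto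
  then show ?case using assms by simp
next
  case (Suc k)
  have eq: "(T ^^ Suc k) -` Z \<inter> space M = T -` ((T ^^ k) -` Z \<inter> space M) \<inter> space M"
    using T_in by (auto simp: funpow_swap1)
  have sets: "(T ^^ k) -` Z \<inter> space M \<in> sets M" using Suc by (rule null_setsD2)
  show ?case unfolding eq
    using null_setsD1[OF Suc] emeasure_T_vimage[OF sets] measurable_sets[OF T_measurable sets]
    by (intro null_setsI) simp_all
qed

lemma eq_mod_null_image:
  assumes "A \<in> sets M" "B \<in> sets M" "eq_mod_null M A B"
  shows "eq_mod_null M ((T ^^ k) ` A) ((T ^^ k) ` B)"
proof (rule eq_mod_nullI)
  show "(T ^^ k) ` sym_diff A B \<in> null_sets M"
    using assms(3) null_sets_funpow_T_image by (simp add: eq_mod_null_def)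
qed (use assms funpow_T_image_sets in auto)

lemma funpow_image_Int:
  assumes "A \<subseteq> space M" "E \<subseteq> space M" "bij_betw T E E"
  shows "(T ^^ t) ` (A \<inter> E) = (T ^^ t) ` A \<inter> E"
proof -
  have "(T ^^ t) ` E = E" using bij_betw_funpow[OF assms(3)] by (simp add: bij_betw_def)
  moreover have "inj_on (T ^^ t) (space M)" using bij_funpow_T by (simp add: bij_betw_def)
  ultimately show ?thesis using inj_on_image_Int[of "T ^^ t" "space M" A E] assms by simp
qed

text \<open>Removing all forward images and preimages of \<open>Z\<close> costs only a null set and
  leaves a set invariant in both directions.\<close>

lemma invariant_full_set:
  assumes "Z \<in> null_sets M"
  obtains E where "E \<in> sets M" "space M - E \<in> null_sets M" "E \<inter> Z = {}" "bij_betw T E E"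
proof
  define E where "E = space M - (\<Union>k. (T ^^ k) ` Z \<union> ((T ^^ k) -` Z \<inter> space M))"
  have null: "(\<Union>k. (T ^^ k) ` Z \<union> ((T ^^ k) -` Z \<inter> space M)) \<in> null_sets M"
    using null_sets_funpow_T_image[OF assms] null_sets_funpow_T_vimage[OF assms]
    by (intro null_sets_UN) (auto intro!: null_sets.Un)
  then show "E \<in> sets M" unfolding E_def by auto
  show "space M - E \<in> null_sets M"
    using null sets.sets_into_space[of _ M] by (auto simp: E_def Diff_Diff_Int intro!: null_set_Int1 Int_absorb1)
  have E: "x \<in> E \<longleftrightarrow> x \<in> space M \<and> (\<forall>k. (T ^^ k) x \<notin> Z \<and> x \<notin> (T ^^ k) ` Z)" for x
    by (auto simp: E_def)
  show "E \<inter> Z = {}" using E by (metis Int_emptyI funpow_0)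
  have Zs: "Z \<subseteq> space M" using assms sets.sets_into_space by blast
  have "T x \<in> E \<longleftrightarrow> x \<in> E" if x: "x \<in> space M" for x
  proof
    assume Tx: "T x \<in> E"
    have "(T ^^ k) x \<notin> Z" for k
    proof (cases k)
      case 0
      have "T x \<notin> (T ^^ 1) ` Z" using Tx E by blast
      then show ?thesis using 0 by auto
    next
      case (Suc l)
      then show ?thesis using Tx E[of "T x"] by (simp add: funpow_swap1)
    qed
    moreover have "x \<notin> (T ^^ k) ` Z" for k
    proof
      assume "x \<in> (T ^^ k) ` Z"
      then have "T x \<in> (T ^^ Suc k) ` Z" by auto
      then show False using Tx E by blast
    qed
    ultimately show "x \<in> E" using E x by blast
  next
    assume xE: "x \<in> E"
    have "(T ^^ k) (T x) \<notin> Z" for k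
      using xE E[of x] by (metis funpow_Suc_right o_apply)
    moreover have "T x \<notin> (T ^^ k) ` Z" for k
    proof (cases k)
      case 0
      have "(T ^^ 1) x \<notin> Z" using xE E by blast
      then show ?thesis using 0 by auto
    next
      case (Suc l)
      show ?thesis
      proof
        assume "T x \<in> (T ^^ k) ` Z"
        then obtain z where z: "z \<in> Z" "T x = T ((T ^^ l) z)" using Suc by auto
        then have "x = (T ^^ l) z" using T_inv_T[of x] T_inv_T[of "(T ^^ l) z"] x funpow_T_in[of z l] Zs by auto
        then show False using xE E z(1) by blast
      qed
    qed
    ultimately show "T x \<in> E" using E x T_in by blast
  qed
  moreover have "E \<subseteq> space M" by (auto simp: E_def)
  ultimately show "bij_betw T E E"
    using T_T_inv T_inv_in inj_on_subset[OF bij_betw_imp_inj_on[OF bij_T]]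
    by (intro bij_betw_imageI equalityI subsetI) (force, fastforce, metis image_eqI subsetD)
qed

end

section \<open>Constructions and exact towers\<close>

context mp_system
begin

text \<open>Pieces and spacers are taken as levels over \<open>F (Suc n)\<close>, so the relations
  between them hold exactly. Refinement holds because each level of tower \<open>n + 1\<close> lies
  inside a level of tower \<open>n\<close> or is a spacer.\<close>

lemma rank_one_constructionI:
  fixes F :: "nat \<Rightarrow> 'a set"
  assumes q_pos: "\<And>n. q n > 0" and q_inf: "infinite {n. q n > 1}"
    and summ: "summable (\<lambda>n. real (\<Sum>i<q n. a n i) / real (tower_height q a (Suc n)))"
    and F_sets: "\<And>n. F n \<in> sets M"
    and cut: "\<And>n. F n = (\<Union>i<q n. (T ^^ column_offset q a n i) ` F (Suc n))"
    and disj: "\<And>n k l z z'. \<lbrakk>z \<in> F n; z' \<in> F n; k < tower_height q a n; l < tower_height q a n;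
                (T ^^ k) z = (T ^^ l) z'\<rbrakk> \<Longrightarrow> k = l"
    and gen: "generates_mod_null M (\<Union>n. tower_partition M T (F n) (tower_height q a n))"
  shows "rank_one_construction M T q a F (\<lambda>n i. (T ^^ column_offset q a n i) ` F (Suc n))
    (\<lambda>n i j. (T ^^ (column_offset q a n i + tower_height q a n + j)) ` F (Suc n))"
proof -
  let ?h = "tower_height q a" and ?c = "column_offset q a"
  have h_pos: "?h n > 0" for n by (induction n) (use q_pos in auto)
  have c_less: "?c n i < ?h (Suc n)" if "i < q n" for n i
    using h_pos[of n] column_offset_height[where q=q and a=a, OF that] by linarith
  have disj': "(T ^^ k) ` F n \<inter> (T ^^ l) ` F n = {}" if "k < ?h n" "l < ?h n" "k \<noteq> l" for n k l
    using disj[of _ n _ k l] that by auto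
  have refines: "refines_mod_null M (tower_partition M T (F (Suc n)) (?h (Suc n))) (tower_partition M T (F n) (?h n))"
    for n
    unfolding refines_mod_null_def
  proof
    fix A assume A: "A \<in> tower_partition M T (F (Suc n)) (?h (Suc n))"
    have sub: "(T ^^ (?c n i + l)) ` F (Suc n) \<subseteq> (T ^^ l) ` F n" if "i < q n" for i l
    proof -
      have "(T ^^ ?c n i) ` F (Suc n) \<subseteq> F n" using cut[of n] that by auto
      then show ?thesis by (auto simp: add.commute funpow_add)
    qed
    have union: "(T ^^ l) ` F n = (\<Union>i<q n. (T ^^ (?c n i + l)) ` F (Suc n))" for l
      by (subst cut) (auto simp: image_UN funpow_image_image add.commute)
    have "\<exists>B\<in>tower_partition M T (F n) (?h n). A \<subseteq> B"
    proof (cases "A = space M - (\<Union>k<?h (Suc n). (T ^^ k) ` F (Suc n))")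
      case True
      have "(T ^^ l) ` F n \<subseteq> (\<Union>k<?h (Suc n). (T ^^ k) ` F (Suc n))" if l: "l < ?h n" for l
      proof -
        have "?c n i + l < ?h (Suc n)" if "i < q n" for i
          using column_offset_height[where q=q and a=a, OF that] l by linarith
        then show ?thesis unfolding union by blast
      qed
      then have "A \<subseteq> space M - (\<Union>l<?h n. (T ^^ l) ` F n)" using True by blast
      then show ?thesis unfolding tower_partition_def by blast
    next
      case False
      then obtain k where k: "k < ?h (Suc n)" "A = (T ^^ k) ` F (Suc n)"
        using A unfolding tower_partition_def by blast
      show ?thesis
      \<comment> \<open>A level of tower \<open>n + 1\<close> either runs through one of the columns
        or is a spacer level, which misses tower \<open>n\<close> entirely.\<close>
      proof (cases "\<exists>i<q n. \<exists>l<?h n. k = ?c n i + l")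
        case True
        then obtain i l where i: "i < q n" "l < ?h n" "k = ?c n i + l" by blast
        then have "A \<subseteq> (T ^^ l) ` F n" using sub k(2) by simp
        then show ?thesis using i(2) unfolding tower_partition_def by blast
      next
        case F: False
        have "A \<inter> (T ^^ l) ` F n = {}" if l: "l < ?h n" for l
        proof -
          have "(T ^^ k) ` F (Suc n) \<inter> (T ^^ (?c n i + l)) ` F (Suc n) = {}" if i: "i < q n" for i
            using column_offset_height[where q=q and a=a, OF i] l F i k(1) by (intro disj') auto
          then show ?thesis unfolding union k(2) by blast
        qed
        moreover have "A \<subseteq> space M"
          unfolding k(2) using funpow_T_image_sets[OF F_sets] by (rule sets.sets_into_space)
        ultimately have "A \<subseteq> space M - (\<Union>l<?h n. (T ^^ l) ` F n)" by blast
        then show ?thesis unfolding tower_partition_def by blast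
      qed
    qed
    then obtain B where "B \<in> tower_partition M T (F n) (?h n)" "A - B = {}" by blast
    then show "\<exists>B\<in>tower_partition M T (F n) (?h n). A - B \<in> null_sets M" by (metis null_sets.empty_sets)
  qed
  show ?thesis
    unfolding rank_one_construction_def Let_def
  proof (intro conjI allI impI)
    fix n show "eq_mod_null M (\<Union>i<q n. (T ^^ ?c n i) ` F (Suc n)) (F n)" by (simp flip: cut)
  next
    fix n i j assume "i < q n" "j < q n" "i \<noteq> j"
    moreover from this have "?c n i \<noteq> ?c n j"
      using column_offset_less[of i j q a n] column_offset_less[of j i q a n] h_pos[of n]
      by (cases "i < j") auto
    ultimately have "(T ^^ ?c n i) ` F (Suc n) \<inter> (T ^^ ?c n j) ` F (Suc n) = {}"
      using c_less by (intro disj') auto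
    then show "disjoint_mod_null M ((T ^^ ?c n i) ` F (Suc n)) ((T ^^ ?c n j) ` F (Suc n))"
      by (simp add: disjoint_mod_null_def)
  next
    fix n k l assume "k < ?h n" "l < ?h n" "k \<noteq> l"
    then show "disjoint_mod_null M ((T ^^ k) ` F n) ((T ^^ l) ` F n)"
      using disj' by (simp add: disjoint_mod_null_def)
  next
    fix n i assume "i < q n" "a n i \<noteq> 0"
    show "eq_mod_null M ((T ^^ ?h n) ` (T ^^ ?c n i) ` F (Suc n)) ((T ^^ (?c n i + ?h n + 0)) ` F (Suc n))"
      by (simp add: funpow_image_image add.commute)
  next
    fix n i assume "Suc i < q n \<and> a n i = 0"
    then show "eq_mod_null M ((T ^^ ?h n) ` (T ^^ ?c n i) ` F (Suc n)) ((T ^^ ?c n (Suc i)) ` F (Suc n))"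
      by (simp add: funpow_image_image column_offset_Suc add.commute)
  next
    fix n i j assume "i < q n" "Suc j < a n i"
    show "eq_mod_null M (T ` (T ^^ (?c n i + ?h n + j)) ` F (Suc n)) ((T ^^ (?c n i + ?h n + Suc j)) ` F (Suc n))"
      by (simp add: image_image)
  next
    fix n i assume i: "Suc i < q n \<and> a n i \<noteq> 0"
    then have "T ` (T ^^ (?c n i + ?h n + (a n i - 1))) ` F (Suc n) = (T ^^ ?c n (Suc i)) ` F (Suc n)"
      using funpow_image_image[of 1 T "?c n i + ?h n + (a n i - 1)" "F (Suc n)"]
      by (simp add: column_offset_Suc)
    then show "eq_mod_null M (T ` (T ^^ (?c n i + ?h n + (a n i - 1))) ` F (Suc n)) ((T ^^ ?c n (Suc i)) ` F (Suc n))"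
      by simp
  qed (use q_pos q_inf summ F_sets refines gen funpow_T_image_sets[OF F_sets] in \<open>simp_all del: tower_height.simps\<close>)
qed

end

section \<open>From a construction to exact towers\<close>

lemma rank_one_constructionD:
  assumes "rank_one_construction M T q a F FF W"
  shows "q n > 0"
    and "infinite {n. q n > 1}"
    and "F n \<in> sets M"
    and "i < q n \<Longrightarrow> FF n i \<in> sets M"
    and "\<lbrakk>i < q n; j < a n i\<rbrakk> \<Longrightarrow> W n i j \<in> sets M"
    and "eq_mod_null M (\<Union>i<q n. FF n i) (F n)"
    and "\<lbrakk>k < tower_height q a n; l < tower_height q a n; k \<noteq> l\<rbrakk> \<Longrightarrow>
           disjoint_mod_null M ((T ^^ k) ` F n) ((T ^^ l) ` F n)"
    and "\<lbrakk>i < q n; a n i \<noteq> 0\<rbrakk> \<Longrightarrow> eq_mod_null M ((T ^^ tower_height q a n) ` FF n i) (W n i 0)"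
    and "\<lbrakk>Suc i < q n; a n i = 0\<rbrakk> \<Longrightarrow> eq_mod_null M ((T ^^ tower_height q a n) ` FF n i) (FF n (Suc i))"
    and "\<lbrakk>i < q n; Suc j < a n i\<rbrakk> \<Longrightarrow> eq_mod_null M (T ` W n i j) (W n i (Suc j))"
    and "\<lbrakk>Suc i < q n; a n i \<noteq> 0\<rbrakk> \<Longrightarrow> eq_mod_null M (T ` W n i (a n i - 1)) (FF n (Suc i))"
    and "eq_mod_null M (F (Suc n)) (FF n 0)"
    and "generates_mod_null M (\<Union>n. tower_partition M T (F n) (tower_height q a n))"
  by -
    (insert assms, unfold rank_one_construction_def Let_def, (elim conjE, simp only: simp_thms)+)

context mp_system
begin

lemma eq_mod_null_T_image:
  assumes "A \<in> sets M" "B \<in> sets M" "eq_mod_null M A B"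
  shows "eq_mod_null M (T ` A) (T ` B)"
  using eq_mod_null_image[OF assms, of 1] by simp

text \<open>From one piece to the next the orbit passes \<open>tower_height q a n\<close> tower
  levels and \<open>a n i\<close> spacers. By induction every piece is a translate of the first one,
  \<open>F (Suc n)\<close>, by the column offset.\<close>

lemma construction_cut_mod_null:
  assumes roc: "rank_one_construction M T q a F FF W"
  shows "eq_mod_null M (F n) (\<Union>i<q n. (T ^^ column_offset q a n i) ` F (Suc n))"
proof -
  let ?h = "tower_height q a" and ?c = "column_offset q a"
  note D = rank_one_constructionD[OF roc]
  have spacer: "eq_mod_null M (W n i j) ((T ^^ (?h n + j)) ` FF n i)" if i: "i < q n" "j < a n i" for i j
    using i(2)
  proof (induction j)
    case 0
    then show ?case using D(8)[of i n] i(1) by (simp add: eq_mod_null_sym)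
  next
    case (Suc j)
    have "j < a n i" using Suc.prems by simp
    have base: "(T ^^ (?h n + j)) ` FF n i \<in> sets M" using D(4)[OF i(1)] by (rule funpow_T_image_sets)
    have "eq_mod_null M (W n i (Suc j)) (T ` W n i j)"
      using D(10)[OF i(1) Suc.prems] by (rule eq_mod_null_sym)
    moreover have "eq_mod_null M (T ` W n i j) (T ` (T ^^ (?h n + j)) ` FF n i)"
      using D(5)[OF i(1) \<open>j < a n i\<close>] base Suc.IH[OF \<open>j < a n i\<close>] by (rule eq_mod_null_T_image)
    ultimately have "eq_mod_null M (W n i (Suc j)) (T ` (T ^^ (?h n + j)) ` FF n i)"
      by (rule eq_mod_null_trans[OF D(5)[OF i(1) Suc.prems] T_image_sets[OF base]])
    then show ?case by (simp add: image_image)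
  qed
  have step: "eq_mod_null M (FF n (Suc i)) ((T ^^ (?h n + a n i)) ` FF n i)" if i: "Suc i < q n" for i
  proof (cases "a n i = 0")
    case True
    then show ?thesis using D(9)[OF i] by (simp add: eq_mod_null_sym)
  next
    case False
    let ?A = "T ` (T ^^ (?h n + (a n i - 1))) ` FF n i"
    have sets: "FF n (Suc i) \<in> sets M" "FF n i \<in> sets M" "W n i (a n i - 1) \<in> sets M"
      using D(4)[of "Suc i" n] D(4)[of i n] D(5)[of i n "a n i - 1"] i False by simp_all
    note base = funpow_T_image_sets[OF sets(2), of "?h n + (a n i - 1)"]
    have "eq_mod_null M (FF n (Suc i)) (T ` W n i (a n i - 1))"
      using D(11)[OF i False] by (rule eq_mod_null_sym)
    moreover have "eq_mod_null M (T ` W n i (a n i - 1)) ?A"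
      using spacer[of i "a n i - 1"] i False by (intro eq_mod_null_T_image sets base) simp
    ultimately have "eq_mod_null M (FF n (Suc i)) ?A"
      by (rule eq_mod_null_trans[OF sets(1) T_image_sets[OF base]])
    moreover have "?A = (T ^^ (?h n + a n i)) ` FF n i"
      using funpow_image_image[of 1 T "?h n + (a n i - 1)" "FF n i"] False by simp
    ultimately show ?thesis by simp
  qed
  have piece: "eq_mod_null M (FF n i) ((T ^^ ?c n i) ` F (Suc n))" if "i < q n" for i
    using that
  proof (induction i)
    case 0
    then show ?case using D(12)[of n] by (simp add: eq_mod_null_sym)
  next
    case (Suc i)
    let ?t = "?h n + a n i"
    have sets: "FF n (Suc i) \<in> sets M" "FF n i \<in> sets M"
      using D(4)[of "Suc i" n] D(4)[of i n] Suc.prems by simp_all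
    note base = funpow_T_image_sets[OF D(3), of "?c n i" "Suc n"]
    have "eq_mod_null M ((T ^^ ?t) ` FF n i) ((T ^^ ?t) ` (T ^^ ?c n i) ` F (Suc n))"
      using Suc by (intro eq_mod_null_image sets base) simp
    with step[OF Suc.prems] have "eq_mod_null M (FF n (Suc i)) ((T ^^ ?t) ` (T ^^ ?c n i) ` F (Suc n))"
      by (rule eq_mod_null_trans[OF sets(1) funpow_T_image_sets[OF base]])
    moreover have "?t + ?c n i = ?c n (Suc i)" by (simp add: column_offset_Suc)
    ultimately show ?case unfolding funpow_image_image by simp
  qed
  have "eq_mod_null M (\<Union>i<q n. FF n i) (\<Union>i<q n. (T ^^ ?c n i) ` F (Suc n))"
    by (intro eq_mod_null_UN funpow_T_image_sets D(3) D(4) piece) auto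
  with eq_mod_null_sym[OF D(6)] show ?thesis
    by (rule eq_mod_null_trans[rotated 2]) (intro sets.finite_UN funpow_T_image_sets D(3) finite_lessThan)+
qed

text \<open>The \<open>h\<close> levels are disjoint, all have the measure of \<open>B\<close>, and
  fit into a probability space.\<close>

lemma emeasure_tower_base_le:
  assumes "B \<in> sets M" "\<And>z z' k l. \<lbrakk>z \<in> B; z' \<in> B; k < h; l < h; (T ^^ k) z = (T ^^ l) z'\<rbrakk> \<Longrightarrow> k = l"
  shows "of_nat h * emeasure M B \<le> 1"
proof -
  have "of_nat h * emeasure M B = (\<Sum>k<h. emeasure M ((T ^^ k) ` B))"
    using emeasure_funpow_T_image[OF assms(1)] by simp
  also have "\<dots> = emeasure M (\<Union>k<h. (T ^^ k) ` B)"
    using assms funpow_T_image_sets[OF assms(1)]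
    by (intro sum_emeasure) (auto simp: disjoint_family_on_def dest: assms(2))
  also have "\<dots> \<le> 1" by (rule emeasure_le_1)
  finally show ?thesis .
qed

text \<open>The cut and disjointness relations are countably many and each fails on a null set only;
  an invariant set of full measure avoids all exceptions.\<close>

lemma construction_imp_towers:
  assumes roc: "rank_one_construction M T q a F FF W"
  obtains E where "E \<in> sets M" "space M - E \<in> null_sets M" "towers T E q a (\<lambda>n. F n \<inter> E)"
proof -
  let ?h = "tower_height q a" and ?c = "column_offset q a"
  note D = rank_one_constructionD[OF roc]
  let ?R = "\<lambda>n. \<Union>i<q n. (T ^^ ?c n i) ` F (Suc n)"
  define Z where "Z = (\<Union>n. sym_diff (F n) (?R n)) \<union>
    (\<Union>n k l. if k < ?h n \<and> l < ?h n \<and> k \<noteq> l then (T ^^ k) ` F n \<inter> (T ^^ l) ` F n else {})"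
  have "Z \<in> null_sets M"
    unfolding Z_def
  proof (rule null_sets.Un)
    show "(\<Union>n. sym_diff (F n) (?R n)) \<in> null_sets M"
      using construction_cut_mod_null[OF roc] unfolding eq_mod_null_def by (rule null_sets_UN)
    have "(if k < ?h n \<and> l < ?h n \<and> k \<noteq> l then (T ^^ k) ` F n \<inter> (T ^^ l) ` F n else {}) \<in> null_sets M"
      for n k l using D(7)[of k n l] by (simp add: disjoint_mod_null_def)
    then show "(\<Union>n k l. if k < ?h n \<and> l < ?h n \<and> k \<noteq> l then (T ^^ k) ` F n \<inter> (T ^^ l) ` F n else {}) \<in> null_sets M"
      by (intro null_sets_UN)
  qed
  then obtain E where E: "E \<in> sets M" "space M - E \<in> null_sets M" "E \<inter> Z = {}" "bij_betw T E E"
    by (rule invariant_full_set)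
  have Esub: "E \<subseteq> space M" using E(1) by (rule sets.sets_into_space)
  have Fsub: "F n \<subseteq> space M" for n using D(3) by (rule sets.sets_into_space)
  have "towers T E q a (\<lambda>n. F n \<inter> E)"
  proof
    show "F n \<inter> E = (\<Union>i<q n. (T ^^ ?c n i) ` (F (Suc n) \<inter> E))" for n
    proof -
      have "sym_diff (F n) (?R n) \<inter> E = {}" using E(3) unfolding Z_def by blast
      then have "F n \<inter> E = ?R n \<inter> E" by blast
      then show ?thesis by (simp add: funpow_image_Int[OF Fsub Esub E(4)])
    qed
  next
    fix z z' n k l
    assume a: "z \<in> F n \<inter> E" "z' \<in> F n \<inter> E" "k < ?h n" "l < ?h n" "(T ^^ k) z = (T ^^ l) z'"
    show "k = l"
    proof (rule ccontr)
      assume "k \<noteq> l"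
      moreover have "(T ^^ k) z \<in> (T ^^ k) ` F n \<inter> (T ^^ l) ` F n" using a by (metis IntD1 IntI imageI)
      ultimately have "(T ^^ k) z \<in> (if k < ?h n \<and> l < ?h n \<and> k \<noteq> l then (T ^^ k) ` F n \<inter> (T ^^ l) ` F n else {})"
        using a(3,4) by simp
      then have "(T ^^ k) z \<in> Z" unfolding Z_def by blast
      moreover have "(T ^^ k) z \<in> E" using a(1) bij_betw_funpow[OF E(4), of k] by (auto dest: bij_betwE)
      ultimately show False using E(3) by blast
    qed
  qed (use E(4) D(1) in auto)
  then show ?thesis using that E by blast
qed

text \<open>Points in the last copy of all towers from \<open>n\<close> on lie in single levels of
  arbitrarily high towers, hence in a null set. Discarding them for every \<open>n\<close> gives the
  extra assumption of \<open>cut_stack\<close>.\<close>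

lemma construction_imp_cut_stack:
  assumes roc: "rank_one_construction M T q a F FF W"
  obtains E where "E \<in> sets M" "space M - E \<in> null_sets M" "cut_stack T E q a (\<lambda>n. F n \<inter> E)"
proof -
  obtain E0 where E0: "E0 \<in> sets M" "space M - E0 \<in> null_sets M" "towers T E0 q a (\<lambda>n. F n \<inter> E0)"
    using roc by (rule construction_imp_towers)
  interpret E0: towers T E0 q a "\<lambda>n. F n \<inter> E0" by (rule E0(3))
  note D = rank_one_constructionD[OF roc]
  have F0: "F n \<inter> E0 \<in> sets M" for n using D(3) E0(1) by auto
  let ?last = "\<lambda>m. (T ^^ copy_offset q a m (copy_count q m - 1)) ` (F m \<inter> E0)"
  have null: "(\<Inter>m\<in>{n..}. ?last m) \<in> null_sets M" for n
  proof (rule null_setsI)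
    have "emeasure M (\<Inter>m\<in>{n..}. ?last m) \<le> 0 + ennreal e" if e: "e > 0" for e
    proof -
      obtain b :: nat where b: "1 / e \<le> real b" "b > 0"
        using real_arch_simple[of "1/e"] e by (metis divide_pos_pos less_le_trans of_nat_0_less_iff zero_less_one)
      \<comment> \<open>The height of tower \<open>m\<close> is at least
        \<open>copy_count q m\<close>, hence at least \<open>1 / e\<close>.\<close>
      obtain m where m: "m \<ge> n" "b \<le> copy_count q m" using E0.copy_count_unbounded[OF D(2), of n b] by blast
      have "(\<Inter>m\<in>{n..}. ?last m) \<subseteq> ?last m" using m(1) by blast
      then have "emeasure M (\<Inter>m\<in>{n..}. ?last m) \<le> emeasure M (?last m)"
        using funpow_T_image_sets[OF F0] by (intro emeasure_mono) auto
      also have "\<dots> = emeasure M (F m \<inter> E0)" using F0 by (rule emeasure_funpow_T_image)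
      finally have le: "emeasure M (\<Inter>m\<in>{n..}. ?last m) \<le> emeasure M (F m \<inter> E0)" .
      have "of_nat (tower_height q a m) * emeasure M (F m \<inter> E0) \<le> 1"
        by (rule emeasure_tower_base_le[OF F0]) (rule E0.disj)
      then have "real (tower_height q a m) * measure M (F m \<inter> E0) \<le> 1"
        unfolding emeasure_eq_measure by (simp add: ennreal_of_nat_eq_real_of_nat flip: ennreal_mult')
      moreover have "real b \<le> real (tower_height q a m)" using m(2) E0.N_le_h[of m] by simp
      ultimately have "real b * measure M (F m \<inter> E0) \<le> 1"
        using mult_right_mono[of "real b" "real (tower_height q a m)" "measure M (F m \<inter> E0)"] by simp
      then have "measure M (F m \<inter> E0) \<le> 1 / real b" using b(2) by (simp add: field_simps)
      also have "\<dots> \<le> e" using b e by (simp add: field_simps)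
      finally show ?thesis using le by (simp add: emeasure_eq_measure measure_nonneg ennreal_leI order_trans)
    qed
    then show "emeasure M (\<Inter>m\<in>{n..}. ?last m) = 0"
      using ennreal_le_epsilon[of 0 "emeasure M (\<Inter>m\<in>{n..}. ?last m)"] by simp
    show "(\<Inter>m\<in>{n..}. ?last m) \<in> sets M"
      by (intro sets.countable_INT' funpow_T_image_sets[OF F0]) (auto simp: funpow_T_image_sets[OF F0])
  qed
  have "(space M - E0) \<union> (\<Union>n. \<Inter>m\<in>{n..}. ?last m) \<in> null_sets M"
    by (intro null_sets.Un null_sets_UN null E0(2))
  then obtain E where E: "E \<in> sets M" "space M - E \<in> null_sets M"
      "E \<inter> ((space M - E0) \<union> (\<Union>n. \<Inter>m\<in>{n..}. ?last m)) = {}" "bij_betw T E E"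
    by (rule invariant_full_set)
  have EE0: "E \<subseteq> E0" using E(3) sets.sets_into_space[OF E(1)] by blast
  then have int: "F n \<inter> E0 \<inter> E = F n \<inter> E" for n by blast
  interpret E: towers T E q a "\<lambda>n. F n \<inter> E"
    using E0.towers_restrict[OF E(4) EE0] by (simp only: int)
  have "cut_stack T E q a (\<lambda>n. F n \<inter> E)"
  proof
    fix x n assume x: "x \<in> F 0 \<inter> E"
    then obtain m where m: "m \<ge> n" "x \<notin> ?last m" using E(3) by blast
    obtain j z where j: "j < copy_count q m" "z \<in> F m \<inter> E" "x = (T ^^ copy_offset q a m j) z"
      using x by (subst (asm) E.base_copies[of m]) auto
    have "j \<noteq> copy_count q m - 1" using m(2) j EE0 by blast
    then have "Suc j < copy_count q m" using j(1) by simp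
    then show "\<exists>m\<ge>n. \<exists>j. Suc j < copy_count q m \<and> x \<in> (T ^^ copy_offset q a m j) ` (F m \<inter> E)"
      using m(1) j by blast
  qed
  then show ?thesis using that E by blast
qed

end

section \<open>Recognizable constructions are expansive\<close>

text \<open>Orbits starting in the invariant set \<open>E\<close> never leave it. The test can
  therefore be phrased with \<open>F 0\<close> alone, which lies in the sigma-algebra of names while
  \<open>E\<close> may not.\<close>

lemma returns_as_restrict:
  assumes "bij_betw T E E" "x \<in> E"
  shows "returns_as T (B \<inter> E) m f x \<longleftrightarrow> returns_as T B m f x"
proof -
  have in_E: "(T ^^ t) y \<in> E" if "y \<in> E" for t y
    using bij_betw_funpow[OF assms(1)] that by (meson bij_betwE)
  have rt: "return_time T (B \<inter> E) y = return_time T B y" if "y \<in> E" for y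
    unfolding return_time_def using in_E[OF that] by simp
  have rm: "return_map T (B \<inter> E) y = return_map T B y" "return_map T B y \<in> E" if "y \<in> E" for y
    unfolding return_map_def rt[OF that] using in_E[OF that] by simp_all
  have iter: "(return_map T (B \<inter> E) ^^ i) x = (return_map T B ^^ i) x \<and> (return_map T B ^^ i) x \<in> E" for i
    by (induction i) (auto simp: assms(2) rm)
  show ?thesis unfolding returns_as_def using iter rt by simp
qed

text \<open>\<open>M\<close> is any measurable space on which \<open>T\<close> is measurable, since
  the result is applied to the sigma-algebra generated by the translates of
  \<open>F 0\<close>.\<close>

lemma returns_as_measurable:
  assumes T: "T \<in> measurable M M" and B: "B \<in> sets M"
  shows "{x \<in> space M. returns_as T B m f x} \<in> sets M"
proof -
  have funpow: "T ^^ t \<in> measurable M M" for t using T by (rule measurable_compose_n)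
  have pred_B: "(\<lambda>x. (T ^^ t) x \<in> B) \<in> measurable M (count_space UNIV)" for t
    using measurable_compose[OF funpow pred_sets2[OF B]] funpow B by (simp add: pred_sets2)
  then have rt: "return_time T B \<in> measurable M (count_space UNIV)"
    unfolding return_time_def by measurable
  have "return_map T B \<in> measurable M M"
    unfolding return_map_def using funpow rt by (rule measurable_compose_countable)
  then have "return_map T B ^^ i \<in> measurable M M" for i by (rule measurable_compose_n)
  then have "(\<lambda>x. return_time T B ((return_map T B ^^ i) x)) \<in> measurable M (count_space UNIV)" for i
    using rt by (rule measurable_compose)
  note [measurable] = this
  show ?thesis unfolding returns_as_def by measurable
qed

context mp_system
begin


lemma T_image_iterate_int:
  assumes "A \<subseteq> space M"
  shows "T ` iterate_int M T k ` A = iterate_int M T (k + 1) ` A"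
proof (cases "k \<ge> 0")
  case True
  then have "nat (k + 1) = Suc (nat k)" by simp
  then show ?thesis using True by (simp add: iterate_int_def image_image)
next
  case False
  have inv_in: "(T_inv ^^ n) y \<in> space M" if "y \<in> space M" for n y
    by (induction n) (auto simp: that T_inv_in)
  obtain n where n: "nat (- k) = Suc n" using False by (cases "nat (- k)") auto
  then have n': "nat (- (k + 1)) = n" by simp
  have "T ` (T_inv ^^ Suc n) ` A = (T_inv ^^ n) ` A"
    unfolding image_image using inv_in T_T_inv assms by (intro image_cong) auto
  moreover have "iterate_int M T (k + 1) = T_inv ^^ n"
    using n n' False by (cases "k = -1") (auto simp: iterate_int_def)
  ultimately show ?thesis using False n by (simp add: iterate_int_def)
qed

lemma iterate_int_image_sets:
  assumes "A \<in> sets M"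
  shows "iterate_int M T k ` A \<in> sets M"
proof -
  have A: "A \<subseteq> space M" using assms by (rule sets.sets_into_space)
  have "iterate_int M T (- int n) ` A \<in> sets M" for n
  proof (induction n)
    case 0
    show ?case using assms by (simp add: iterate_int_def)
  next
    case (Suc n)
    let ?B = "iterate_int M T (- int (Suc n)) ` A"
    have eq: "T ` ?B = iterate_int M T (- int n) ` A" using T_image_iterate_int[OF A, of "- int (Suc n)"] by simp
    have inv_in: "(T_inv ^^ n) y \<in> space M" if "y \<in> space M" for n y
      by (induction n) (auto simp: that T_inv_in)
    have "?B \<subseteq> space M" using inv_in A by (auto simp: iterate_int_def T_inv_in)
    then have "?B = T -` iterate_int M T (- int n) ` A \<inter> space M" using T_vimage_image eq by metis
    then show ?case using measurable_sets[OF T_measurable Suc] by simp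
  qed
  moreover have "iterate_int M T (int n) ` A \<in> sets M" for n
    using funpow_T_image_sets[OF assms] by (simp add: iterate_int_def)
  ultimately show ?thesis by (metis int_cases2)
qed

text \<open>The translates of \<open>F 0\<close> form a family invariant under \<open>T\<close> and
  its inverse, so both are measurable for the sigma-algebra it generates. The test defines sets
  \<open>U n\<close> in that sigma-algebra, equal to \<open>F n\<close> modulo null sets, and their
  images under iterates of \<open>T\<close> belong to it too.\<close>

lemma recognizable_imp_expansive:
  assumes roc: "rank_one_construction M T q a F FF W"
    and E: "E \<in> sets M" "space M - E \<in> null_sets M" "bij_betw T E E"
    and rec: "\<And>n. F n \<inter> E = {x \<in> F 0 \<inter> E. returns_as T (F 0 \<inter> E) (copy_count q n) (copy_offset q a n) x}"
  shows "essentially_0_expansive M T F"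
proof -
  note D = rank_one_constructionD[OF roc]
  define C where "C = range (\<lambda>k. iterate_int M T k ` F 0)"
  have C: "C \<subseteq> sets M" unfolding C_def using iterate_int_image_sets[OF D(3)] by auto
  have F0: "F 0 \<subseteq> space M" using D(3) by (rule sets.sets_into_space)
  define M' where "M' = sigma (space M) C"
  have C_space: "C \<subseteq> Pow (space M)" using C sets.space_closed by blast
  then have M': "space M' = space M" "sets M' = sigma_sets (space M) C"
    unfolding M'_def by (simp_all add: sets_measure_of)
  have C_T: "T ` A \<in> C" if "A \<in> C" for A
    using that T_image_iterate_int[OF F0] unfolding C_def by blast
  have C_T_inv: "T -` A \<inter> space M \<in> C" if A: "A \<in> C" for A
  proof -
    obtain k where k: "A = iterate_int M T k ` F 0" using A unfolding C_def by blast
    let ?B = "iterate_int M T (k - 1) ` F 0"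
    have "A = T ` ?B" using T_image_iterate_int[OF F0, of "k - 1"] k by simp
    moreover have "?B \<subseteq> space M" using iterate_int_image_sets[OF D(3)] by (rule sets.sets_into_space)
    ultimately have "T -` A \<inter> space M = ?B"
      using T_vimage_image by simp
    then show ?thesis unfolding C_def by auto
  qed
  have T_M': "T \<in> measurable M' M'"
    unfolding M'_def
  proof (rule measurable_sigma_sets[OF sets_measure_of[OF C_space] C_space])
    show "T \<in> space (sigma (space M) C) \<rightarrow> space M" using T_in C_space by auto
    show "T -` A \<inter> space (sigma (space M) C) \<in> sets (sigma (space M) C)" if "A \<in> C" for A
      using C_T_inv[OF that] C_space by (auto simp: sets_measure_of)
  qed
  have Tinv_M': "T_inv \<in> measurable M' M'"
    unfolding M'_def
  proof (rule measurable_sigma_sets[OF sets_measure_of[OF C_space] C_space])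
    show "T_inv \<in> space (sigma (space M) C) \<rightarrow> space M" using T_inv_in C_space by auto
    show "T_inv -` A \<inter> space (sigma (space M) C) \<in> sets (sigma (space M) C)" if "A \<in> C" for A
      using C_T[OF that] T_image_eq[of A] C_space that by (auto simp: sets_measure_of)
  qed
  have image_M': "(T ^^ k) ` A \<in> sets M'" if "A \<in> sets M'" for A k
  proof (induction k)
    case (Suc k)
    then have "(T ^^ k) ` A \<subseteq> space M" using sets.sets_into_space M'(1) by metis
    then have "(T ^^ Suc k) ` A = T_inv -` ((T ^^ k) ` A) \<inter> space M'"
      using T_image_eq[of "(T ^^ k) ` A"] M'(1) by (simp add: image_image)
    then show ?case using measurable_sets[OF Tinv_M' Suc] by simp
  qed (use that in simp)
  have "F 0 \<in> C" unfolding C_def by (auto simp: iterate_int_def intro!: image_eqI[of _ _ 0])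
  then have F0_M': "F 0 \<in> sets M'" unfolding M'(2) by (rule sigma_sets.Basic)
  \<comment> \<open>The test without \<open>E\<close>, so that \<open>U n\<close> is built from
    \<open>F 0\<close> and \<open>T\<close> only.\<close>
  define U where "U n = {x \<in> space M'. returns_as T (F 0) (copy_count q n) (copy_offset q a n) x} \<inter> F 0" for n
  have U_M': "U n \<in> sets M'" for n
    unfolding U_def using returns_as_measurable[OF T_M' F0_M'] F0_M' by (rule sets.Int)
  have M'_M: "A \<in> sets M" if "A \<in> sets M'" for A
    using that sigma_sets_in_sets[OF C] unfolding M'(2) by blast
  have FU: "eq_mod_null M (F n) (U n)" for n
  proof (rule eq_mod_nullI[OF D(3) M'_M[OF U_M'] E(2)])
    fix x assume "x \<in> space M" "x \<notin> space M - E"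
    then have xE: "x \<in> E" by blast
    have "x \<in> F n \<longleftrightarrow> x \<in> F n \<inter> E" using xE by blast
    also have "\<dots> \<longleftrightarrow> x \<in> F 0 \<inter> E \<and> returns_as T (F 0 \<inter> E) (copy_count q n) (copy_offset q a n) x"
      by (subst rec) simp
    also have "\<dots> \<longleftrightarrow> x \<in> U n"
      using returns_as_restrict[OF E(3) xE] F0 M'(1) xE unfolding U_def by blast
    finally show "x \<in> F n \<longleftrightarrow> x \<in> U n" .
  qed
  have "(T ^^ k) ` F n \<in> sets_mod_null M C" for k n
    unfolding sets_mod_null_def
    using eq_mod_null_image[OF D(3) M'_M[OF U_M'] FU] image_M'[OF U_M'] unfolding M'(2)
    by (intro CollectI conjI funpow_T_image_sets D(3) bexI)
  then have "(\<Union>n. tower_partition M T (F n) (tower_height q a n)) \<subseteq> sets_mod_null M C"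
    by (intro UN_least tower_partition_subset_sets_mod_null C)
  then show ?thesis unfolding essentially_0_expansive_def
    using generates_mod_null_transfer[OF D(13) C] unfolding C_def by blast
qed

end

section \<open>The periodic case\<close>

context cut_stack
begin

text \<open>The factor \<open>2 ^ (k + 2)\<close> makes the proportion discarded at stage
  \<open>k\<close> summable and provides at least four copies per stage.\<close>

lemma sparse_stages:
  assumes "infinite {n. q n > 1}"
  obtains m where "m 0 = n" "\<And>k. m k < m (Suc k)" "\<And>k. 2 ^ (k + 2) * N (m k) \<le> N (m (Suc k))"
proof -
  have ex: "\<exists>y>x. 2 ^ (k + 2) * N x \<le> N y" for x k :: nat
    using copy_count_unbounded[OF assms, of "Suc x"] by (meson Suc_le_lessD)
  define f where "f k x = (SOME y. y > x \<and> 2 ^ (k + 2) * N x \<le> N y)" for k x :: nat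
  have f: "f k x > x \<and> 2 ^ (k + 2) * N x \<le> N (f k x)" for k x
    unfolding f_def by (rule someI_ex) (rule ex)
  show thesis
    by (rule that[of "rec_nat n f"]) (use f in auto)
qed

text \<open>A return to \<open>H m\<close> before height \<open>h m\<close> would make two levels of
  the tower meet.\<close>

lemma height_le_period:
  assumes "periodic n p" "m \<ge> n"
  shows "h m \<le> p * (N m div N n)"
proof (rule ccontr)
  assume c: "\<not> ?thesis"
  have per: "\<And>y t. y \<in> H m \<Longrightarrow> (T ^^ t) y \<in> H m \<longleftrightarrow> p * (N m div N n) dvd t" and H0: "H 0 \<noteq> {}" and "p > 0"
    using assms unfolding periodic_def by auto
  then have pos: "p * (N m div N n) > 0"
    using copy_count_dvd[OF assms(2), of q] N_pos[of m] N_pos[of n] by (auto elim!: dvdE)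
  obtain y where y: "y \<in> H m" using H0 base_copies[of m] by auto
  have "(T ^^ (p * (N m div N n))) y \<in> H m" using per[OF y] by simp
  then have "p * (N m div N n) = 0"
    using disj[OF y, of "(T ^^ (p * (N m div N n))) y" "p * (N m div N n)" 0] c by simp
  then show False using pos by simp
qed

lemma periodic_imp_odometer_towers:
  assumes per: "periodic n p" and m: "m 0 = n" "\<And>k. m k < m (Suc k)"
  shows "odometer_towers T E (\<lambda>k. H (m k)) (\<lambda>k. p * (N (m k) div N n)) (\<lambda>k. N (m (Suc k)) div N (m k))"
proof
  have mono: "m k \<le> m l" if "k \<le> l" for k l
    by (rule lift_Suc_mono_le[where f = m, OF less_imp_le[OF m(2)] that])
  have ge: "m k \<ge> n" for k using mono[of 0 k] m(1) by simp
  have dvd: "N n dvd N (m k)" "N (m k) dvd N (m (Suc k))" for k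
    using copy_count_dvd ge mono[of k "Suc k"] by auto
  show "bij_betw T E E" "H (m k) \<subseteq> E" for k by (rule bij) (rule H_subset)
  show "0 < p * (N (m k) div N n)" for k
    using per dvd(1)[of k] N_pos[of "m k"] N_pos[of n] unfolding periodic_def by (auto elim!: dvdE)
  show "p * (N (m (Suc k)) div N n) = N (m (Suc k)) div N (m k) * (p * (N (m k) div N n))" for k
  proof -
    obtain b c where bc: "N (m k) = N n * b" "N (m (Suc k)) = N (m k) * c" using dvd by (metis dvdE)
    have "b > 0" using bc(1) N_pos[of "m k"] by (cases b) auto
    then show ?thesis using bc N_pos[of n] by simp
  qed
  show "(T ^^ t) y \<in> H (m k) \<longleftrightarrow> p * (N (m k) div N n) dvd t" if "y \<in> H (m k)" for y k t
    using per ge that unfolding periodic_def by blast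
  show "H (m (Suc k)) \<subseteq> H (m k)" for k using H_antimono mono by simp
  show "H (m k) \<subseteq> (\<Union>t<p * (N (m (Suc k)) div N n). (T ^^ t) ` H (m (Suc k)))" for k
  proof
    fix y assume "y \<in> H (m k)"
    then have "y \<in> H 0" using H_antimono[of 0 "m k"] by blast
    then obtain z where z: "z \<in> H (m (Suc k))" "y = (T ^^ copy_offset q a (m (Suc k)) (copy_index (m (Suc k)) y)) z"
        "copy_index (m (Suc k)) y < N (m (Suc k))"
      by (rule copy_indexE)
    \<comment> \<open>Copies lie below the height of their tower, which is at most the return
      time.\<close>
    then have "copy_offset q a (m (Suc k)) (copy_index (m (Suc k)) y) < p * (N (m (Suc k)) div N n)"
      using copy_offset_less height_le_period[OF per ge] less_le_trans by blast
    then show "y \<in> (\<Union>t<p * (N (m (Suc k)) div N n). (T ^^ t) ` H (m (Suc k)))" using z by blast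
  qed
qed

text \<open>By downward induction from \<open>m\<close>, each level is a finite union of levels of
  the next tower.\<close>

lemma levels_sets_mod_null:
  assumes "C \<subseteq> sets M" "n \<le> m" "\<And>s. s < h m \<Longrightarrow> (T ^^ s) ` H m \<in> sets_mod_null M C" "s < h n"
  shows "(T ^^ s) ` H n \<in> sets_mod_null M C"
  using assms(2,4)
proof (induction arbitrary: s rule: inc_induct)
  case base
  then show ?case using assms(3) by simp
next
  case (step n)
  have "(T ^^ s) ` H n = (\<Union>i<q n. (T ^^ (s + c n i)) ` H (Suc n))"
    by (subst cut) (simp add: image_UN funpow_image_image)
  also have "\<dots> \<in> sets_mod_null M C"
  proof (rule sets_mod_null_UN[OF assms(1)])
    fix i assume "i \<in> {..<q n}"
    then have "s + c n i < h (Suc n)"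
      using column_offset_height[where q = q and a = a and n = n and i = i] step.prems by simp
    then show "(T ^^ (s + c n i)) ` H (Suc n) \<in> sets_mod_null M C" by (rule step.IH)
  qed
  finally show ?case .
qed

end

section \<open>Generation and non-periodicity of the new towers\<close>

locale mp_odometer = mp_system M T + odometer_towers T E J P Q
  for M :: "'a measure" and T E J P Q +
  assumes J_sets: "J k \<in> sets M"
    and Q_large: "2 ^ (k + 2) \<le> Q k"
begin

lemma Q_ge_4: "Q k \<ge> 4"
proof -
  have "(4::nat) \<le> 2 ^ (k + 2)" by simp
  then show ?thesis using Q_large order_trans by blast
qed

lemma Q_ge_2: "Q k \<ge> 2"
  using Q_ge_4[of k] by simp

lemma G_sets: "G k \<in> sets M"
proof -
  have "(\<Union>s<(Q l - 1) * P l. (T ^^ s) ` J (Suc l)) \<in> sets M" for l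
    by (intro sets.finite_UN funpow_T_image_sets J_sets) auto
  then show ?thesis unfolding G_def by (intro sets.Int J_sets sets.countable_INT') auto
qed

lemma top_copy_sets: "top_copy l \<in> sets M"
  unfolding top_copy_def using funpow_T_image_sets[OF J_sets] by (intro sets.finite_UN) auto

text \<open>The top copy consists of \<open>P l\<close> of the \<open>Q l * P l\<close> disjoint
  levels over \<open>J (Suc l)\<close>, hence has measure at most \<open>1 / Q l\<close>.\<close>

lemma measure_top_copy: "measure M (top_copy l) \<le> (1/2) ^ l"
proof -
  have "emeasure M (top_copy l) \<le> (\<Sum>s<P l. emeasure M ((T ^^ ((Q l - 1) * P l + s)) ` J (Suc l)))"
    unfolding top_copy_def using funpow_T_image_sets[OF J_sets] by (intro emeasure_subadditive_finite) auto
  also have "\<dots> = of_nat (P l) * emeasure M (J (Suc l))"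
    using emeasure_funpow_T_image[OF J_sets] by simp
  finally have "measure M (top_copy l) \<le> real (P l) * measure M (J (Suc l))"
    unfolding emeasure_eq_measure by (simp add: ennreal_of_nat_eq_real_of_nat flip: ennreal_mult')
  moreover have "of_nat (P (Suc l)) * emeasure M (J (Suc l)) \<le> 1"
    by (rule emeasure_tower_base_le[OF J_sets]) (rule J_levels_disjoint(1))
  then have "real (P (Suc l)) * measure M (J (Suc l)) \<le> 1"
    unfolding emeasure_eq_measure by (simp add: ennreal_of_nat_eq_real_of_nat flip: ennreal_mult')
  then have "real (Q l) * (real (P l) * measure M (J (Suc l))) \<le> 1" by (simp add: P_Suc mult_ac)
  ultimately have "real (Q l) * measure M (top_copy l) \<le> 1"
    by (meson mult_left_mono of_nat_0_le_iff order_trans)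
  moreover have "(2::nat) ^ l \<le> Q l"
    using Q_large[of l] by (simp add: power_add)
  then have "2 ^ l \<le> real (Q l)" by (metis of_nat_le_iff of_nat_numeral of_nat_power)
  ultimately have "2 ^ l * measure M (top_copy l) \<le> 1"
    by (meson measure_nonneg mult_right_mono order_trans)
  then show ?thesis by (simp add: power_divide field_simps)
qed

text \<open>By Borel--Cantelli almost every point lies in only finitely many top copies;
  \<open>J_eventually_G\<close> then places a point of \<open>J k\<close> in a tower over some
  \<open>G m\<close>.\<close>

lemma J_mod_null:
  "eq_mod_null M (J k) (\<Union>m\<in>{k..}. \<Union>t\<in>{t. t < P m \<and> P k dvd t}. (T ^^ t) ` G m)"
proof -
  have "AE x in M. eventually (\<lambda>l. x \<in> space M - top_copy l) sequentially"
  proof (rule borel_cantelli_AE1[OF top_copy_sets])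
    show "summable (\<lambda>l. measure M (top_copy l))"
      by (rule summable_comparison_test'[where g = "\<lambda>l. (1/2 :: real) ^ l" and N = 0])
        (use measure_top_copy in auto)
  qed (simp add: emeasure_eq_measure)
  then obtain Z where Z:
      "{x \<in> space M. \<not> eventually (\<lambda>l. x \<in> space M - top_copy l) sequentially} \<subseteq> Z"
      "emeasure M Z = 0" "Z \<in> sets M"
    by (rule AE_E)
  show ?thesis
  proof (rule eq_mod_nullI[OF J_sets _ null_setsI[OF Z(2,3)]])
    show "(\<Union>m\<in>{k..}. \<Union>t\<in>{t. t < P m \<and> P k dvd t}. (T ^^ t) ` G m) \<in> sets M"
      using funpow_T_image_sets[OF G_sets] by (intro sets.countable_UN'') auto
  next
    fix x assume "x \<in> space M" "x \<notin> Z"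
    then have "eventually (\<lambda>l. x \<in> space M - top_copy l) sequentially" using Z(1) by blast
    then obtain m where m: "\<And>l. l \<ge> m \<Longrightarrow> x \<notin> top_copy l" unfolding eventually_sequentially by blast
    show "x \<in> J k \<longleftrightarrow> x \<in> (\<Union>m\<in>{k..}. \<Union>t\<in>{t. t < P m \<and> P k dvd t}. (T ^^ t) ` G m)"
    proof
      assume "x \<in> J k"
      then obtain t where "t < P (max k m)" "P k dvd t" "x \<in> (T ^^ t) ` G (max k m)"
        using J_eventually_G[of x k "max k m"] m by auto
      then show "x \<in> (\<Union>m\<in>{k..}. \<Union>t\<in>{t. t < P m \<and> P k dvd t}. (T ^^ t) ` G m)" by force
    next
      assume "x \<in> (\<Union>m\<in>{k..}. \<Union>t\<in>{t. t < P m \<and> P k dvd t}. (T ^^ t) ` G m)"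
      then obtain m t z where z: "k \<le> m" "P k dvd t" "z \<in> G m" "x = (T ^^ t) z" by auto
      then have "z \<in> J k" using G_subset_J J_antimono by blast
      then show "x \<in> J k" using J_visit z by blast
    qed
  qed
qed

text \<open>Recovers the levels of the old sparse towers from the new ones, so declaring the top
  copies to be spacers loses no information.\<close>

lemma gap_towers_generate_J:
  fixes C defines "C \<equiv> (\<Union>n. tower_partition M T (G' n) (tower_height q' a' n))"
  shows "C \<subseteq> sets M" and "s < P k \<Longrightarrow> (T ^^ s) ` J k \<in> sets_mod_null M C"
proof -
  have G': "G' n \<in> sets M" for n by (simp add: G'_def G_sets)
  show C: "C \<subseteq> sets M" unfolding C_def tower_partition_def
    using funpow_T_image_sets[OF G'] by (auto intro!: sets.Diff sets.top sets.finite_UN)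
  have level: "(T ^^ s) ` G k \<in> sets_mod_null M C" if "s < P k" for s k
  proof (rule sets_mod_null_basic[OF C])
    have "(T ^^ s) ` G k \<in> tower_partition M T (G' (Suc k)) (tower_height q' a' (Suc k))"
      unfolding gap_height[OF Q_ge_2] tower_partition_def G'_def using that by simp
    then show "(T ^^ s) ` G k \<in> C" unfolding C_def by blast
  qed
  show "(T ^^ s) ` J k \<in> sets_mod_null M C" if s: "s < P k"
  proof (rule sets_mod_null_cong[OF C funpow_T_image_sets[OF J_sets]])
    let ?U = "\<Union>m\<in>{k..}. \<Union>t\<in>{t. t < P m \<and> P k dvd t}. (T ^^ t) ` G m"
    have "?U \<in> sets M" using funpow_T_image_sets[OF G_sets] by (intro sets.countable_UN'') auto
    then show "eq_mod_null M ((T ^^ s) ` J k) ((T ^^ s) ` ?U)"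
      by (rule eq_mod_null_image[OF J_sets _ J_mod_null])
    have "(T ^^ s) ` ?U = (\<Union>m\<in>{k..}. \<Union>t\<in>{t. t < P m \<and> P k dvd t}. (T ^^ (s + t)) ` G m)"
      by (simp add: image_UN funpow_image_image)
    also have "\<dots> \<in> sets_mod_null M C"
    proof (intro sets_mod_null_UN C level)
      fix m t assume m: "m \<in> {k..}" and t: "t \<in> {t. t < P m \<and> P k dvd t}"
      \<comment> \<open>\<open>P m - t\<close> is a positive multiple of \<open>P k\<close>, so
        \<open>s + t\<close> stays inside tower \<open>m\<close>.\<close>
      then have "P k dvd P m - t" using P_dvd[of k m] by simp
      then have "P k \<le> P m - t" using t by (intro dvd_imp_le) auto
      then show "s + t < P m" using s by simp
    qed
    finally show "(T ^^ s) ` ?U \<in> sets_mod_null M C" .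
  qed
qed

text \<open>At stage \<open>k + 1\<close> the proportion of spacers is
  \<open>P k / P (Suc k) = 1 / Q k\<close>, which is summable because \<open>Q\<close> grows at
  least geometrically.\<close>

lemma gap_construction:
  assumes "generates_mod_null M (\<Union>n. tower_partition M T (G' n) (tower_height q' a' n))"
  shows "\<exists>FF W. rank_one_construction M T q' a' G' FF W"
proof -
  have pos: "q' n > 0" for n using Q_ge_4[of "n - 1"] by (cases n) auto
  have "Suc k \<in> {n. q' n > 1}" for k using Q_ge_4[of k] by simp
  then have "range Suc \<subseteq> {n. q' n > 1}" by blast
  then have inf: "infinite {n. q' n > 1}" 
    using range_inj_infinite[of Suc] by (rule infinite_super) simp
  have "real (\<Sum>i<q' (Suc k). a' (Suc k) i) / real (tower_height q' a' (Suc (Suc k))) \<le> (1/2) ^ k" for k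
  proof -
    have "(2::nat) ^ k \<le> Q k" using Q_large[of k] by (simp add: power_add)
    then have le: "2 ^ k \<le> real (Q k)" by (metis of_nat_le_iff of_nat_numeral of_nat_power)
    have "real (\<Sum>i<q' (Suc k). a' (Suc k) i) / real (tower_height q' a' (Suc (Suc k))) = real (P k) / real (P (Suc k))"
      using gap_height[OF Q_ge_2, of "Suc k"] gap_spacers_sum[OF Q_ge_2, of k]
      by (simp del: gap_spacers.simps tower_height.simps)
    also have "\<dots> = 1 / real (Q k)" using P_pos[of k] by (simp add: P_Suc)
    also have "\<dots> \<le> 1 / 2 ^ k" using le by (intro frac_le) auto
    finally show ?thesis by (simp add: power_divide)
  qed
  then have bound: "norm (real (\<Sum>i<q' (Suc k). a' (Suc k) i) / real (tower_height q' a' (Suc (Suc k)))) \<le> (1/2) ^ k" for k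
    by (simp only: real_norm_def abs_divide abs_of_nat)
  have "summable (\<lambda>k. real (\<Sum>i<q' (Suc k). a' (Suc k) i) / real (tower_height q' a' (Suc (Suc k))))"
    by (rule summable_comparison_test'[where N = 0, OF summable_geometric bound]) simp
  then have summ: "summable (\<lambda>n. real (\<Sum>i<q' n. a' n i) / real (tower_height q' a' (Suc n)))"
    by (subst (asm) summable_Suc_iff)
  have sets: "G' n \<in> sets M" for n by (simp add: G'_def G_sets)
  show ?thesis
    by (intro exI, rule rank_one_constructionI[OF pos inf summ sets gap_cut[OF Q_ge_2] _ assms])
      (rule gap_disjoint[OF Q_ge_2])
qed

text \<open>A constant return time \<open>r\<close> to \<open>G n\<close> would divide
  \<open>P n\<close>, since over \<open>G (Suc n)\<close> the two lowest copies are kept. It would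
  then divide \<open>(Q n - 1) * P n\<close> and force a visit in the discarded copy.\<close>

lemma gap_construction_not_periodic:
  assumes "cut_stack T E' q' a' (\<lambda>n. G' n \<inter> E')"
  shows "\<not> cut_stack.periodic T q' (\<lambda>n. G' n \<inter> E') n p"
proof
  interpret cs: cut_stack T E' q' a' "\<lambda>n. G' n \<inter> E'" by (rule assms)
  assume per: "cs.periodic n p"
  \<comment> \<open>The period at stage \<open>n + 1\<close>, one of the stages covered by
    \<open>periodic n p\<close>; there \<open>G' (Suc n) = G n\<close>.\<close>
  define r where "r = p * (copy_count q' (Suc n) div copy_count q' n)"
  have visit: "(T ^^ t) y \<in> G n \<longleftrightarrow> r dvd t" if "y \<in> G n" "y \<in> E'" for t y
  proof -
    have "\<forall>y\<in>G' (Suc n) \<inter> E'. \<forall>t. (T ^^ t) y \<in> G' (Suc n) \<inter> E' \<longleftrightarrow> r dvd t"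
      using per unfolding cs.periodic_def r_def by simp
    then have "(T ^^ t) y \<in> G' (Suc n) \<inter> E' \<longleftrightarrow> r dvd t" using that unfolding G'_def by simp
    then show ?thesis using cs.funpow_in_E[OF that(2), of t] by (simp add: G'_def)
  qed
  have "G' 0 \<inter> E' \<noteq> {}" using per unfolding cs.periodic_def by blast
  then have "G' (Suc (Suc n)) \<inter> E' \<noteq> {}" using cs.base_copies[of "Suc (Suc n)"] by auto
  then obtain z where z: "z \<in> G (Suc n)" "z \<in> E'" by (auto simp: G'_def)
  have Qn: "0 < Q n - 1" "1 < Q n - 1" using Q_ge_4[of n] by auto
  have "(T ^^ (i * P n)) z \<in> G n" if "i < Q n - 1" for i
    using G_cut[of n] z(1) that by blast
  from this[OF Qn(1)] this[OF Qn(2)] have "z \<in> G n" "(T ^^ P n) z \<in> G n" by simp_all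
  then have "r dvd (Q n - 1) * P n" using visit z(2) by simp
  then have "(T ^^ ((Q n - 1) * P n)) z \<in> G n" using visit z(2) \<open>z \<in> G n\<close> by blast
  then show False using G_avoids_top_copy[OF z(1) Q_ge_2] by blast
qed

end

section \<open>An expansive construction on the given system\<close>

lemma measure_preserving_system_imp_mp_system:
  assumes "measure_preserving_system M T"
  shows "mp_system M T"
proof -
  interpret prob_space M
    using assms unfolding measure_preserving_system_def nonatomic_Lebesgue_space_def by blast
  show ?thesis
    by unfold_locales (use assms in \<open>auto simp: measure_preserving_system_def\<close>)
qed

text \<open>The transformation is never changed; in the periodic alternative a new construction
  replaces the old one, and the dichotomy is applied again with periodicity excluded.\<close>

lemma (in mp_system) expansive_construction_exists:
  assumes roc: "rank_one_construction M T q a F FF W"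
  shows "\<exists>q a G GG W. rank_one_construction M T q a G GG W \<and> essentially_0_expansive M T G"
proof -
  obtain E where E: "E \<in> sets M" "space M - E \<in> null_sets M" "cut_stack T E q a (\<lambda>n. F n \<inter> E)"
    using roc by (rule construction_imp_cut_stack)
  interpret E: cut_stack T E q a "\<lambda>n. F n \<inter> E" by (rule E(3))
  note D = rank_one_constructionD[OF roc]
  from E.recognizable_or_periodic show ?thesis
  proof
    assume "\<forall>n. F n \<inter> E = {x \<in> F 0 \<inter> E. E.looks_like_start n x}"
    then have "essentially_0_expansive M T F"
      using recognizable_imp_expansive[OF roc E(1,2) E.bij] by blast
    then show ?thesis using roc by blast
  next
    assume "\<exists>n p. E.periodic n p"
    then obtain n p where per: "E.periodic n p" by blast
    obtain m where m: "m 0 = n" "\<And>k. m k < m (Suc k)" "\<And>k. 2 ^ (k + 2) * E.N (m k) \<le> E.N (m (Suc k))"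
      using E.sparse_stages[OF D(2), of n] by blast
    let ?J = "\<lambda>k. F (m k) \<inter> E" and ?P = "\<lambda>k. p * (E.N (m k) div E.N n)"
      and ?Q = "\<lambda>k. E.N (m (Suc k)) div E.N (m k)"
    have J_sets: "?J k \<in> sets M" for k using D(3) E(1) by auto
    interpret O: odometer_towers T E ?J ?P ?Q
      using per m(1,2) by (rule E.periodic_imp_odometer_towers)
    interpret O: mp_odometer M T E ?J ?P ?Q
    proof
      show "2 ^ (k + 2) \<le> ?Q k" for k
        using m(3)[of k] E.N_pos[of "m k"] by (simp add: less_eq_div_iff_mult_less_eq)
    qed (rule J_sets)
    let ?C = "\<Union>n. tower_partition M T (O.G' n) (tower_height O.q' O.a' n)"
    note C = O.gap_towers_generate_J(1)
    \<comment> \<open>Old levels are unions of levels at the sparse stage \<open>m i\<close>, which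
      is at or above both \<open>i\<close> and \<open>n\<close>; those are levels over
      \<open>J i\<close> and hence known to the new towers.\<close>
    have "(T ^^ s) ` F i \<in> sets_mod_null M ?C" if s: "s < E.h i" for s i
    proof (rule sets_mod_null_cong[OF C funpow_T_image_sets[OF D(3)]])
      have "strict_mono m" using m(2) by (simp add: strict_mono_Suc_iff)
      then have "i \<le> m i" by (rule strict_mono_imp_increasing)
      have "n \<le> m i" using \<open>strict_mono m\<close> m(1) by (metis le0 strict_mono_less_eq)
      show "(T ^^ s) ` (F i \<inter> E) \<in> sets_mod_null M ?C"
      proof (rule E.levels_sets_mod_null[OF C \<open>i \<le> m i\<close> _ s])
        fix s assume "s < E.h (m i)"
        then have "s < ?P i" using E.height_le_period[OF per \<open>n \<le> m i\<close>] by simp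
        then show "(T ^^ s) ` (F (m i) \<inter> E) \<in> sets_mod_null M ?C" by (rule O.gap_towers_generate_J(2))
      qed
      have FE: "F i \<inter> E \<in> sets M" using D(3) E(1) by (rule sets.Int)
      show "eq_mod_null M ((T ^^ s) ` F i) ((T ^^ s) ` (F i \<inter> E))"
        by (rule eq_mod_null_image[OF D(3) FE eq_mod_nullI[OF D(3) FE E(2)]]) simp
    qed
    then have "(\<Union>n. tower_partition M T (F n) (E.h n)) \<subseteq> sets_mod_null M ?C"
      by (intro UN_least tower_partition_subset_sets_mod_null C)
    then have "generates_mod_null M ?C" by (rule generates_mod_null_transfer[OF D(13) C])
    then obtain GG V where roc': "rank_one_construction M T O.q' O.a' O.G' GG V"
      using O.gap_construction by blast
    obtain E' where E': "E' \<in> sets M" "space M - E' \<in> null_sets M" "cut_stack T E' O.q' O.a' (\<lambda>n. O.G' n \<inter> E')"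
      using roc' by (rule construction_imp_cut_stack)
    interpret E': cut_stack T E' O.q' O.a' "\<lambda>n. O.G' n \<inter> E'" by (rule E'(3))
    have "\<forall>n. O.G' n \<inter> E' = {x \<in> O.G' 0 \<inter> E'. E'.looks_like_start n x}"
      using E'.recognizable_or_periodic O.gap_construction_not_periodic[OF E'(3)] by blast
    then have "essentially_0_expansive M T O.G'"
      using recognizable_imp_expansive[OF roc' E'(1,2) E'.bij] by blast
    then show ?thesis using roc' by blast
  qed
qed

text \<open>The expansive construction lives on the given system itself, so the identity serves as
  the isomorphism.\<close>

lemma isomorphic_systems_refl:
  assumes "measure_preserving_system M T"
  shows "isomorphic_systems M T M T"
proof -
  have "T ` space M = space M" using assms by (simp add: measure_preserving_system_def bij_betw_def)
  moreover have "inv_into (space M) id \<in> measurable M M"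
    by (rule measurable_cong[THEN iffD1, OF _ measurable_ident]) (simp add: inv_into_f_eq)
  moreover have "restrict_space M (space M) = M"
    by (rule measure_eqI) (auto simp: sets_restrict_space emeasure_restrict_space image_iff
        dest: sets.sets_into_space)
  ultimately show ?thesis
    unfolding isomorphic_systems_def isomorphism_on_def full_measure_set_def
    by (intro exI[of _ "space M"] exI[of _ id]) (auto simp: id_def bij_betw_def)
qed

theorem theorem6p1:
  fixes M :: "'a measure" and T :: "'a \<Rightarrow> 'a"
  assumes "rank_one_system M T"
  shows "\<exists>(N :: 'a measure) S.
           rank_one_system N S \<and>
           (\<exists>q a G GG W. rank_one_construction N S q a G GG W \<and> essentially_0_expansive N S G) \<and>
           isomorphic_systems N S M T"
proof -
  have mps: "measure_preserving_system M T" using assms by (simp add: rank_one_system_def)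
  then interpret mp_system M T by (rule measure_preserving_system_imp_mp_system)
  have "\<exists>q a G GG W. rank_one_construction M T q a G GG W \<and> essentially_0_expansive M T G"
    using assms expansive_construction_exists unfolding rank_one_system_def by blast
  then show ?thesis using assms isomorphic_systems_refl[OF mps] by blast
qed

end
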